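(* Let $n\geq5$ and let $\mathcal{B}:=\mathfrak{R}_{\sec\geq0}(n)\setminus\bigcup_{m\geq0}\mathfrak{I}_m$. For all $R\in\mathrm{Sym}^2_b(\wedge^2\mathbb{R}^n)\setminus\mathcal{B}$, the algorithm described in the context (on input $R$) terminates, and it returns TRUE if and only if $\sec_R\geq0$. Moreover, the set of bad inputs $\mathcal{B}$ has measure zero in $\mathrm{Sym}^2_b(\wedge^2\mathbb{R}^n)$ and is contained in the topological boundary $\partial\mathfrak{R}_{\sec\geq0}(n)$.
   Context: Equip $\mathbb{R}^n$ with its standard inner product and $\wedge^2\mathbb{R}^n$ with the induced inner product $\langle\cdot,\cdot\rangle$ (so that $e_i\wedge e_j$, $i<j$, is an orthonormal basis). $\mathrm{Sym}^2_b(\wedge^2\mathbb{R}^n)$ is the space of symmetric endomorphisms $R$ of $\wedge^2\mathbb{R}^n$ satisfying the first Bianchi identity $\langle R(X\wedge Y),Z\wedge W\rangle+\langle R(Y\wedge Z),X\wedge W\rangle+\langle R(Z\wedge X),Y\wedge W\rangle=0$ for all $X,Y,Z,W\in\mathbb{R}^n$. The sectional curvature of $R$ is $\sec_R(\sigma)=\langle R(\sigma),\sigma\rangle$ on $\{\sigma=X\wedge Y:\|X\wedge Y\|=1\}$, and $\mathfrak{R}_{\sec\geq0}(n)=\{R\in\mathrm{Sym}^2_b(\wedge^2\mathbb{R}^n):\sec_R\geq0\}$. Inner approximations. Let $x_{ij}$, $1\leq i<j\leq n$, be the Plücker coordinates on $\wedge^2\mathbb{C}^n$, let $\mathrm{Gr}_2(n)\subset\mathbb{P}(\wedge^2\mathbb{C}^n)$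 be the Grassmannian of $2$-planes, and $\mathbb{R}[\mathrm{Gr}_2(n)]=\mathbb{R}[x_{ij}]/I$ its real homogeneous coordinate ring, where $I$ is generated by the Plücker relations; subscripts denote graded pieces. Identifying $R$ with the class of the quadratic form $\langle R\alpha,\alpha\rangle$, $\alpha=\sum_{i<j}x_{ij}e_i\wedge e_j$, gives a linear isomorphism $\mathrm{Sym}^2_b(\wedge^2\mathbb{R}^n)\cong\mathbb{R}[\mathrm{Gr}_2(n)]_2$. With $r=\sum_{i<j}x_{ij}^2$, let $\mathfrak{I}_m$ ($m\geq0$) be the set of $P\in\mathbb{R}[\mathrm{Gr}_2(n)]_2\cong\mathrm{Sym}^2_b(\wedge^2\mathbb{R}^n)$ such that $r^m P\in\mathbb{R}[\mathrm{Gr}_2(n)]_{2m+2}$ is a sum of squares of elements of $\mathbb{R}[\mathrm{Gr}_2(n)]_{m+1}$. Outer approximations. Let $\mathrm{Sym}^p_0\mathbb{R}^n$ be the space of harmonic homogeneous polynomials of degree $p$ in $x_1,\dots,x_n$ (with its $\mathsf{O}(n)$-invariant inner product). For $R\in\mathrm{Sym}^2_b(\wedge^2\mathbb{R}^n)$, $\mathcal{K}(R,\mathrm{Sym}^p_0\mathbb{R}^n)$ is the symmetric endomorphism of $\mathrm{Sym}^p_0\mathbb{R}^n$ determined by $\langle\mathcal{K}(R,\mathrm{Sym}^p_0\mathbb{R}^n)\psi,\psi\rangle=c_{p,n}\int_{S^{n-1}}\langle R(x\wedge\nabla\psi(x)),x\wedge\nabla\psi(x)\rangle\,\mathrm{d}x$,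 with $c_{p,n}>0$ a constant. Let $\mathfrak{O}_m=\{R\in\mathrm{Sym}^2_b(\wedge^2\mathbb{R}^n):\mathcal{K}(R,\mathrm{Sym}^p_0\mathbb{R}^n)\succeq0\text{ for all }1\leq p\leq m+1\}$. Algorithm (input $R\in\mathrm{Sym}^2_b(\wedge^2\mathbb{R}^n)$). Start with $m=0$ and loop: if $R\in\mathfrak{I}_m$, stop and return TRUE; otherwise, if $R\notin\mathfrak{O}_m$, stop and return FALSE; otherwise replace $m$ by $m+1$ and repeat. The membership tests (carried out by semidefinite programming) are treated as exact yes/no queries. *)

theory Defs
  imports "HOL-Analysis.Analysis" "HOL-Library.Poly_Mapping"
begin

section \<open>Bivectors\<close>

text \<open>
  \<open>'n\<close> is the index set of the standard basis of \<open>\<real>\<^sup>n\<close>, so \<open>n = CARD('n)\<close>. The pairs \<open>i < j\<close> index the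
  orthonormal basis \<open>e\<^sub>i \<and> e\<^sub>j\<close> of \<open>\<Lambda>\<^sup>2\<real>\<^sup>n\<close>. The second disjunct is void as soon as
  \<open>CARD('n) \<ge> 2\<close>; it is there only because HOL types must be nonempty.
\<close>

typedef (overloaded) 'n biv_index =
  "{(i::'n::{finite,linorder}, j). i < j \<or> (\<forall>x y::'n. x = y)}"
  by auto (metis neq_iff)

instance biv_index :: ("{finite,linorder}") finite
proof
  have "range Rep_biv_index \<subseteq> (UNIV :: ('a \<times> 'a) set)" by simp
  then have "finite (range (Rep_biv_index :: 'a biv_index \<Rightarrow> 'a \<times> 'a))"
    by (rule finite_subset) simp
  then show "finite (UNIV :: 'a biv_index set)"
    by (rule finite_imageD) (simp add: inj_on_def Rep_biv_index_inject)
qed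

type_synonym 'n bivector = "real ^ 'n biv_index"

definition wedge :: "real ^ ('n::{finite,linorder}) \<Rightarrow> real ^ ('n::{finite,linorder}) \<Rightarrow> 'n bivector"
    (infixl \<open>\<and>\<^sub>v\<close> 75) where
  "X \<and>\<^sub>v Y = (\<chi> q. let (i, j) = Rep_biv_index q in X $ i * Y $ j - X $ j * Y $ i)"


section \<open>Algebraic curvature operators\<close>

text \<open>
  An endomorphism of \<open>\<Lambda>\<^sup>2\<real>\<^sup>n\<close> is given by its matrix in the basis \<open>e\<^sub>i \<and> e\<^sub>j\<close>.
\<close>

definition sym2b :: "(real ^ 'n biv_index ^ ('n::{finite,linorder}) biv_index) set" where
  "sym2b = {R. (\<forall>\<alpha> \<beta>. (R *v \<alpha>) \<bullet> \<beta> = \<alpha> \<bullet> (R *v \<beta>)) \<and>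
     (\<forall>X Y Z W. (R *v (X \<and>\<^sub>v Y)) \<bullet> (Z \<and>\<^sub>v W) + (R *v (Y \<and>\<^sub>v Z)) \<bullet> (X \<and>\<^sub>v W)
              + (R *v (Z \<and>\<^sub>v X)) \<bullet> (Y \<and>\<^sub>v W) = 0)}"

lemma subspace_sym2b:
  "subspace (sym2b :: (real ^ 'n biv_index ^ ('n::{finite,linorder}) biv_index) set)"
  unfolding subspace_def sym2b_def
proof (intro conjI allI ballI impI CollectI; (elim CollectE conjE)?)
  fix x y :: "real ^ 'n biv_index ^ 'n biv_index" and X Y Z W :: "real ^ ('n::{finite,linorder})"
  assume "\<forall>X Y Z W. (x *v (X \<and>\<^sub>v Y)) \<bullet> (Z \<and>\<^sub>v W) + (x *v (Y \<and>\<^sub>v Z)) \<bullet> (X \<and>\<^sub>v W)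
      + (x *v (Z \<and>\<^sub>v X)) \<bullet> (Y \<and>\<^sub>v W) = 0"
    and "\<forall>X Y Z W. (y *v (X \<and>\<^sub>v Y)) \<bullet> (Z \<and>\<^sub>v W) + (y *v (Y \<and>\<^sub>v Z)) \<bullet> (X \<and>\<^sub>v W)
      + (y *v (Z \<and>\<^sub>v X)) \<bullet> (Y \<and>\<^sub>v W) = 0"
  from this[rule_format, of X Y Z W]
  show "((x + y) *v (X \<and>\<^sub>v Y)) \<bullet> (Z \<and>\<^sub>v W) + ((x + y) *v (Y \<and>\<^sub>v Z)) \<bullet> (X \<and>\<^sub>v W)
      + ((x + y) *v (Z \<and>\<^sub>v X)) \<bullet> (Y \<and>\<^sub>v W) = 0"
    by (simp add: matrix_vector_mult_add_rdistrib inner_add_left)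
next
  fix c and x :: "real ^ 'n biv_index ^ 'n biv_index" and X Y Z W :: "real ^ ('n::{finite,linorder})"
  assume "\<forall>X Y Z W. (x *v (X \<and>\<^sub>v Y)) \<bullet> (Z \<and>\<^sub>v W) + (x *v (Y \<and>\<^sub>v Z)) \<bullet> (X \<and>\<^sub>v W)
      + (x *v (Z \<and>\<^sub>v X)) \<bullet> (Y \<and>\<^sub>v W) = 0"
  from this[rule_format, of X Y Z W]
  show "((c *\<^sub>R x) *v (X \<and>\<^sub>v Y)) \<bullet> (Z \<and>\<^sub>v W) + ((c *\<^sub>R x) *v (Y \<and>\<^sub>v Z)) \<bullet> (X \<and>\<^sub>v W)
      + ((c *\<^sub>R x) *v (Z \<and>\<^sub>v X)) \<bullet> (Y \<and>\<^sub>v W) = 0"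
    by (simp add: scaleR_matrix_vector_assoc[symmetric] distrib_left[symmetric])
qed (auto simp: matrix_vector_mult_add_rdistrib inner_add_left inner_add_right
      scaleR_matrix_vector_assoc[symmetric])

lemma mat_1_in_sym2b: "mat 1 \<in> sym2b"
  by (simp add: sym2b_def wedge_def inner_vec_def sum.distrib[symmetric] case_prod_beta
      algebra_simps)

typedef (overloaded) 'n curv_op =
  "sym2b :: (real ^ 'n biv_index ^ ('n::{finite,linorder}) biv_index) set"
  morphisms mat_of Curv_op
  using mat_1_in_sym2b by blast

setup_lifting type_definition_curv_op

text \<open>
  The type \<open>'n curv_op\<close> is made a Euclidean space with the inner product \<open>tr (R S)\<close>, which is
  the restriction of the inner product of matrices. Its topology, \<open>frontier\<close> and \<open>lebesgue\<close> are
  then the usual ones of the finite-dimensional space \<open>Sym\<^sup>2\<^sub>b(\<Lambda>\<^sup>2\<real>\<^sup>n)\<close>.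
\<close>

instantiation curv_op :: ("{finite,linorder}") real_vector
begin

lift_definition zero_curv_op :: "'a curv_op" is 0
  by (rule subspace_0[OF subspace_sym2b])
lift_definition plus_curv_op :: "'a curv_op \<Rightarrow> 'a curv_op \<Rightarrow> 'a curv_op" is "(+)"
  by (rule subspace_add[OF subspace_sym2b])
lift_definition minus_curv_op :: "'a curv_op \<Rightarrow> 'a curv_op \<Rightarrow> 'a curv_op" is "(-)"
  by (rule subspace_diff[OF subspace_sym2b])
lift_definition uminus_curv_op :: "'a curv_op \<Rightarrow> 'a curv_op" is uminus
  by (rule subspace_neg[OF subspace_sym2b])
lift_definition scaleR_curv_op :: "real \<Rightarrow> 'a curv_op \<Rightarrow> 'a curv_op" is "(*\<^sub>R)"
  by (rule subspace_scale[OF subspace_sym2b])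
instance
proof
  fix R S T :: "'a curv_op" and a b :: real
  show "R + S + T = R + (S + T)" by transfer simp
  show "R + S = S + R" by transfer simp
  show "0 + R = R" by transfer simp
  show "- R + R = 0" by transfer simp
  show "R - S = R + - S" by transfer simp
  show "a *\<^sub>R (R + S) = a *\<^sub>R R + a *\<^sub>R S" by transfer (rule scaleR_add_right)
  show "(a + b) *\<^sub>R R = a *\<^sub>R R + b *\<^sub>R R" by transfer (rule scaleR_add_left)
  show "a *\<^sub>R b *\<^sub>R R = (a * b) *\<^sub>R R" by transfer simp
  show "1 *\<^sub>R R = R" by transfer simp
qed

end

instantiation curv_op :: ("{finite,linorder}") real_inner
begin

lift_definition inner_curv_op :: "'a curv_op \<Rightarrow> 'a curv_op \<Rightarrow> real" is "(\<bullet>)" .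
lift_definition norm_curv_op :: "'a curv_op \<Rightarrow> real" is norm .

definition sgn_curv_op :: "'a curv_op \<Rightarrow> 'a curv_op" where
  "sgn_curv_op R = R /\<^sub>R norm R"
definition dist_curv_op :: "'a curv_op \<Rightarrow> 'a curv_op \<Rightarrow> real" where
  "dist_curv_op R S = norm (R - S)"
definition uniformity_curv_op :: "('a curv_op \<times> 'a curv_op) filter" where
  "uniformity_curv_op = (INF e\<in>{0<..}. principal {(R, S). dist R S < e})"
definition open_curv_op :: "'a curv_op set \<Rightarrow> bool" where
  "open_curv_op U \<longleftrightarrow> (\<forall>R\<in>U. \<forall>\<^sub>F (R', S) in uniformity. R' = R \<longrightarrow> S \<in> U)"

instance
proof
  fix R S T :: "'a curv_op" and a :: real and U :: "'a curv_op set"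
  show "sgn R = R /\<^sub>R norm R" by (rule sgn_curv_op_def)
  show "dist R S = norm (R - S)" by (rule dist_curv_op_def)
  show "uniformity = (INF e\<in>{0<..}. principal {(R, S :: 'a curv_op). dist R S < e})"
    by (rule uniformity_curv_op_def)
  show "open U \<longleftrightarrow> (\<forall>R\<in>U. \<forall>\<^sub>F (R', S) in uniformity. R' = R \<longrightarrow> S \<in> U)"
    by (rule open_curv_op_def)
  show "R \<bullet> S = S \<bullet> R" by transfer (rule inner_commute)
  show "(R + S) \<bullet> T = R \<bullet> T + S \<bullet> T" by transfer (rule inner_add_left)
  show "(a *\<^sub>R R) \<bullet> S = a * (R \<bullet> S)" by transfer simp
  show "0 \<le> R \<bullet> R" by transfer simp
  show "R \<bullet> R = 0 \<longleftrightarrow> R = 0" by transfer simp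
  show "norm R = sqrt (R \<bullet> R)" by transfer (rule norm_eq_sqrt_inner)
qed

end

lemma orthonormal_basis_sym2b:
  "\<exists>B \<subseteq> sym2b. pairwise orthogonal B \<and> (\<forall>x\<in>B. norm x = 1) \<and> finite B \<and> span B = sym2b"
  by (rule orthonormal_basis_subspace[OF subspace_sym2b]) (use independent_imp_finite in blast)

instantiation curv_op :: ("{finite,linorder}") euclidean_space
begin

definition Basis_curv_op :: "'a curv_op set" where
  "Basis_curv_op = Curv_op ` (SOME B. B \<subseteq> sym2b \<and> pairwise orthogonal B \<and>
     (\<forall>x\<in>B. norm x = 1) \<and> finite B \<and> span B = sym2b)"

lemma Basis_curv_op_props:
  shows "(Basis :: 'a curv_op set) \<noteq> {}"
    and "finite (Basis :: 'a curv_op set)"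
    and "\<And>u v :: 'a curv_op. u \<in> Basis \<Longrightarrow> v \<in> Basis \<Longrightarrow> u \<bullet> v = (if u = v then 1 else 0)"
    and "\<And>R :: 'a curv_op. (\<forall>u\<in>Basis. R \<bullet> u = 0) \<longleftrightarrow> R = 0"
proof -
  obtain B :: "(real ^ 'a biv_index ^ 'a biv_index) set"
    where Basis: "(Basis :: 'a curv_op set) = Curv_op ` B"
    and B: "B \<subseteq> sym2b" "pairwise orthogonal B" "\<forall>x\<in>B. norm x = 1" "finite B" "span B = sym2b"
    unfolding Basis_curv_op_def
    using someI_ex[OF orthonormal_basis_sym2b] by blast
  have inner_B: "R \<bullet> Curv_op b = mat_of R \<bullet> b" if "b \<in> B" for R b
    using that B(1) by (simp add: inner_curv_op.rep_eq Curv_op_inverse subset_iff)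
  have "B \<noteq> {}"
  proof
    assume "B = {}"
    with B(5) mat_1_in_sym2b have "mat 1 = (0 :: real ^ 'a biv_index ^ 'a biv_index)" by auto
    then have "mat 1 $ i $ i = (0 :: real)" for i :: "'a biv_index" by simp
    then show False by (simp add: mat_def)
  qed
  show "(Basis :: 'a curv_op set) \<noteq> {}" using \<open>B \<noteq> {}\<close> by (simp add: Basis)
  show "finite (Basis :: 'a curv_op set)" using B(4) by (simp add: Basis)
  show "u \<bullet> v = (if u = v then 1 else 0)" if uv: "u \<in> Basis" "v \<in> Basis" for u v :: "'a curv_op"
  proof -
    from uv obtain b c where bc: "b \<in> B" "c \<in> B" "u = Curv_op b" "v = Curv_op c"
      by (auto simp: Basis)
    then have "u = v \<longleftrightarrow> b = c" using B(1) by (auto simp: Curv_op_inject subset_iff)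
    moreover have "u \<bullet> v = b \<bullet> c"
      using bc B(1) by (auto simp: inner_B Curv_op_inverse subset_iff)
    ultimately show ?thesis
      using bc B(2,3) by (auto simp: pairwise_def orthogonal_def norm_eq_1)
  qed
  have "R = 0" if R: "\<forall>u\<in>Basis. R \<bullet> u = 0" for R :: "'a curv_op"
  proof -
    have "orthogonal (mat_of R) b" if "b \<in> B" for b
      using that R by (auto simp: Basis inner_B orthogonal_def)
    then have "orthogonal (mat_of R) (mat_of R)"
      using orthogonal_to_span[of "mat_of R" B "mat_of R"] mat_of[of R] B(5) by simp
    then show "R = 0" by transfer (simp add: orthogonal_def)
  qed
  then show "(\<forall>u\<in>Basis. R \<bullet> u = 0) \<longleftrightarrow> R = 0" for R :: "'a curv_op" by auto
qed

instance
  by standard (fact Basis_curv_op_props)+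

end

definition curv_form :: "('n::{finite,linorder}) curv_op \<Rightarrow> 'n bivector \<Rightarrow> real" where
  "curv_form R \<sigma> = (mat_of R *v \<sigma>) \<bullet> \<sigma>"

definition sec_nonneg :: "('n::{finite,linorder}) curv_op \<Rightarrow> bool" where
  "sec_nonneg R \<longleftrightarrow> (\<forall>\<sigma> \<in> {\<sigma>. \<exists>X Y. \<sigma> = X \<and>\<^sub>v Y \<and> norm (X \<and>\<^sub>v Y) = 1}. curv_form R \<sigma> \<ge> 0)"


section \<open>Inner approximations\<close>

text \<open>
  Polynomials with variables indexed by \<open>'v\<close> are finitely supported functions from exponent
  vectors to coefficients; their product in \<^theory>\<open>HOL-Library.Poly_Mapping\<close> is convolution.
\<close>

type_synonym 'v mpoly = "('v \<Rightarrow>\<^sub>0 nat) \<Rightarrow>\<^sub>0 real"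

definition mvar :: "'v \<Rightarrow> 'v mpoly" where
  "mvar v = Poly_Mapping.single (Poly_Mapping.single v 1) 1"

definition mconst :: "real \<Rightarrow> 'v mpoly" where
  "mconst a = Poly_Mapping.single 0 a"

definition homogeneous :: "nat \<Rightarrow> 'v mpoly \<Rightarrow> bool" where
  "homogeneous d p \<longleftrightarrow> (\<forall>e \<in> Poly_Mapping.keys p.
     (\<Sum>v \<in> Poly_Mapping.keys e. Poly_Mapping.lookup e v) = d)"

definition pvar :: "'n \<Rightarrow> 'n \<Rightarrow> ('n::{finite,linorder}) biv_index mpoly" where
  "pvar i j = mvar (Abs_biv_index (i, j))"

definition pluecker_relations :: "('n::{finite,linorder}) biv_index mpoly set" where
  "pluecker_relations =
     {pvar i j * pvar k l - pvar i k * pvar j l + pvar i l * pvar j k | i j k l.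
        i < j \<and> j < k \<and> k < l}"

text \<open>The span of a set over the ring itself, acting by multiplication, is the ideal it generates.\<close>

definition pluecker_ideal :: "('n::{finite,linorder}) biv_index mpoly set" where
  "pluecker_ideal = module.span (*) pluecker_relations"

text \<open>
  The classes of \<open>p\<close> and \<open>q\<close> in the homogeneous coordinate ring \<open>\<real>[Gr\<^sub>2(n)] = \<real>[x\<^sub>i\<^sub>j]/I\<close> agree.
\<close>

definition coord_ring_eq ::
    "('n::{finite,linorder}) biv_index mpoly \<Rightarrow> 'n biv_index mpoly \<Rightarrow> bool" where
  "coord_ring_eq p q \<longleftrightarrow> p - q \<in> pluecker_ideal"

definition quadratic_poly :: "('n::{finite,linorder}) curv_op \<Rightarrow> 'n biv_index mpoly" where
  "quadratic_poly R = (\<Sum>s\<in>UNIV. \<Sum>t\<in>UNIV. mconst (mat_of R $ s $ t) * mvar t * mvar s)"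

definition r_poly :: "('n::{finite,linorder}) biv_index mpoly" where
  "r_poly = (\<Sum>s\<in>UNIV. mvar s ^ 2)"

text \<open>
  The graded piece \<open>\<real>[Gr\<^sub>2(n)]\<^sub>d\<close> consists of the classes of the homogeneous polynomials of degree \<open>d\<close>.
\<close>

definition inner_approx :: "nat \<Rightarrow> ('n::{finite,linorder}) curv_op set" where
  "inner_approx m = {R. \<exists>(N::nat) q. (\<forall>k<N. homogeneous (m + 1) (q k)) \<and>
     coord_ring_eq (r_poly ^ m * quadratic_poly R) (\<Sum>k<N. q k ^ 2)}"


section \<open>Outer approximations\<close>

definition mpoly_fun :: "'n mpoly \<Rightarrow> real ^ 'n \<Rightarrow> real" where
  "mpoly_fun p x = (\<Sum>e \<in> Poly_Mapping.keys p. Poly_Mapping.lookup p e *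
     (\<Prod>i \<in> Poly_Mapping.keys e. (x $ i) ^ Poly_Mapping.lookup e i))"

definition partial_deriv :: "'n \<Rightarrow> (real ^ 'n \<Rightarrow> real) \<Rightarrow> real ^ 'n \<Rightarrow> real" where
  "partial_deriv i f x = frechet_derivative f (at x) (axis i 1)"

definition gradient :: "(real ^ 'n \<Rightarrow> real) \<Rightarrow> real ^ 'n \<Rightarrow> real ^ 'n" where
  "gradient f x = (\<chi> i. partial_deriv i f x)"

definition laplacian :: "(real ^ 'n \<Rightarrow> real) \<Rightarrow> real ^ 'n \<Rightarrow> real" where
  "laplacian f x = (\<Sum>i\<in>UNIV. partial_deriv i (partial_deriv i f) x)"

definition harmonic_polys :: "nat \<Rightarrow> (real ^ 'n \<Rightarrow> real) set" where
  "harmonic_polys p = {\<psi>. (\<exists>P. homogeneous p P \<and> \<psi> = mpoly_fun P) \<and> (\<forall>x. laplacian \<psi> x = 0)}"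

text \<open>
  The surface measure of \<open>A \<subseteq> S\<^bsup>n-1\<^esup>\<close> is \<open>n\<close> times the volume of the cone
  \<open>{t a | a \<in> A, 0 < t < 1}\<close>.
\<close>

definition sphere_measure :: "(real ^ 'n) measure" where
  "sphere_measure = scale_measure (of_nat CARD('n))
     (distr (restrict_space lborel (ball 0 1)) borel sgn)"

text \<open>
  The \<open>O(n)\<close>-invariant inner product of \<open>Sym\<^sup>p\<^sub>0\<real>\<^sup>n\<close>, which is unique up to a positive factor, is
  normalized to be that of \<open>L\<^sup>2(S\<^bsup>n-1\<^esup>)\<close>.
\<close>

definition sphere_inner :: "(real ^ 'n \<Rightarrow> real) \<Rightarrow> (real ^ 'n \<Rightarrow> real) \<Rightarrow> real" where
  "sphere_inner \<psi> \<phi> = (\<integral>x. \<psi> x * \<phi> x \<partial>sphere_measure)"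

definition symmetric_endo ::
    "(real ^ 'n \<Rightarrow> real) set \<Rightarrow> ((real ^ 'n \<Rightarrow> real) \<Rightarrow> (real ^ 'n \<Rightarrow> real)) \<Rightarrow> bool" where
  "symmetric_endo V K \<longleftrightarrow> K \<in> V \<rightarrow>\<^sub>E V \<and>
     (\<forall>\<psi>\<in>V. \<forall>\<phi>\<in>V. \<forall>a b. K (\<lambda>x. a * \<psi> x + b * \<phi> x) = (\<lambda>x. a * K \<psi> x + b * K \<phi> x)) \<and>
     (\<forall>\<psi>\<in>V. \<forall>\<phi>\<in>V. sphere_inner (K \<psi>) \<phi> = sphere_inner \<psi> (K \<phi>))"

text \<open>
  \<open>c p\<close> is the constant \<open>c\<^bsub>p,n\<^esub>\<close>.
\<close>

definition curvature_term ::
    "(nat \<Rightarrow> real) \<Rightarrow> 'n curv_op \<Rightarrow> nat \<Rightarrow>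
     (real ^ ('n::{finite,linorder}) \<Rightarrow> real) \<Rightarrow> (real ^ ('n::{finite,linorder}) \<Rightarrow> real)" where
  "curvature_term c R p = (THE K. symmetric_endo (harmonic_polys p) K \<and>
     (\<forall>\<psi> \<in> harmonic_polys p. sphere_inner (K \<psi>) \<psi> =
        c p * (\<integral>x. curv_form R (x \<and>\<^sub>v gradient \<psi> x) \<partial>sphere_measure)))"

definition outer_approx :: "(nat \<Rightarrow> real) \<Rightarrow> nat \<Rightarrow> ('n::{finite,linorder}) curv_op set" where
  "outer_approx c m = {R. \<forall>p. 1 \<le> p \<and> p \<le> m + 1 \<longrightarrow>
     (\<forall>\<psi> \<in> harmonic_polys p. sphere_inner (curvature_term c R p \<psi>) \<psi> \<ge> 0)}"


section \<open>The algorithm\<close>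

text \<open>
  \<open>algorithm c R m\<close> runs the loop on input \<open>R\<close> from the counter value \<open>m\<close> on; the value \<open>None\<close>
  means that the loop does not terminate.
\<close>

partial_function (option) algorithm ::
    "(nat \<Rightarrow> real) \<Rightarrow> ('n::{finite,linorder}) curv_op \<Rightarrow> nat \<Rightarrow> bool option" where
  "algorithm c R m =
     (if R \<in> inner_approx m then Some True
      else if R \<notin> outer_approx c m then Some False
      else algorithm c R (m + 1))"

definition bad_inputs :: "('n::{finite,linorder}) curv_op set" where
  "bad_inputs = {R. sec_nonneg R} - (\<Union>m. inner_approx m)"

end

theory Submission
  imports Defs
begin

text \<open>
  If \<open>sec\<^sub>R > 0\<close>, the quadratic form of \<open>R\<close> is positive at every real homomorphism of
  \<open>\<real>[x]/(I, r - 1)\<close> that is nonnegative on squares, since such a homomorphism is a unit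
  decomposable bivector. The sums of squares form an archimedean preordering there, so the form is
  a sum of squares modulo \<open>(I, r - 1)\<close> by the archimedean Positivstellensatz. Substituting \<open>x / \<surd>r\<close>, clearing
  denominators and keeping the terms free of \<open>\<surd>r\<close> turns this into membership in some
  \<open>\<II>\<^sub>m\<close>. Hence a bad input cannot lie in the interior of the convex set
  \<open>sec \<ge> 0\<close>, as it would stay in that set after subtracting a small multiple of the identity;
  and the frontier of a convex set is negligible.

  If \<open>R(u \<and> v, u \<and> v) < 0\<close> for orthonormal \<open>u, v\<close>, the harmonic polynomials
  \<open>Re (x \<bullet> u + i x \<bullet> v)\<^sup>p\<close> and \<open>Im (x \<bullet> u + i x \<bullet> v)\<^sup>p\<close> concentrate
  on the great circle through \<open>u\<close> and \<open>v\<close>, and for large \<open>p\<close> one of them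
  violates \<open>\<K>(R, Sym\<^sup>p\<^sub>0) \<succeq> 0\<close>.
\<close>

section \<open>The archimedean Positivstellensatz\<close>

text \<open>No quotient ring is formed. The Positivstellensatz is applied in the polynomial ring
  itself, to a preordering that contains the ideal: every element of the ideal lies in it with both
  signs, so a homomorphism that is nonnegative on it kills the ideal. The certificate obtained is
  inhomogeneous, whereas \<open>inner_approx m\<close> asks for an identity in one degree with
  homogeneous squares. Clearing denominators never requires cancelling \<open>r_poly\<close> modulo
  the Pluecker ideal: in large degree the substitution sends multiples of r - 1 to 0 and, because
  the Pluecker relations are homogeneous, sends their multiples to multiples of them. The part of a
  square that is odd in the root of r contributes r times a square, which is harmless because r is
  itself a sum of squares.

  On the outer side, \<open>curvature_term\<close> is a definite description, so nothing can be said
  about it before existence and uniqueness are established on a finite-dimensional inner product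
  space. After that only the sign of an integral counts. One negatively curved plane has to be
  detected by an integral over the whole sphere, which is why concentrating test functions are
  needed.\<close>

locale real_scalars =
  fixes C :: "real \<Rightarrow> 'a::comm_ring_1"
  assumes C_add: "C (a + b) = C a + C b"
    and C_mult: "C (a * b) = C a * C b"
    and C_1 [simp]: "C 1 = 1"
begin

lemma C_0 [simp]: "C 0 = 0"
  using C_add[of 0 0] by simp

lemma C_minus: "C (- a) = - C a"
  using C_add[of a "- a"] by (simp add: eq_neg_iff_add_eq_0 add.commute)

lemma C_diff: "C (a - b) = C a - C b"
  using C_add[of a "- b"] by (simp add: C_minus)

text \<open>The condition \<open>- 1 \<notin> P\<close> is not part of the notion: adjoining an
  element then always yields a preordering, and properness is tracked separately in the Zorn
  argument.\<close>

definition preordering :: "'a set \<Rightarrow> bool" where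
  "preordering P \<longleftrightarrow> (\<forall>a\<in>P. \<forall>b\<in>P. a + b \<in> P \<and> a * b \<in> P) \<and> (\<forall>a. a * a \<in> P)"

context
  fixes P
  assumes P: "preordering P"
begin

lemma preordering_add: "a \<in> P \<Longrightarrow> b \<in> P \<Longrightarrow> a + b \<in> P"
  and preordering_mult: "a \<in> P \<Longrightarrow> b \<in> P \<Longrightarrow> a * b \<in> P"
  and preordering_square: "a * a \<in> P"
  using P by (auto simp: preordering_def)

lemma preordering_C: "0 \<le> x \<Longrightarrow> C x \<in> P"
  using preordering_square[of "C (sqrt x)"] by (simp add: C_mult[symmetric])

lemma preordering_1: "1 \<in> P"
  using preordering_C[of 1] by simp

lemma preordering_0: "0 \<in> P"
  using preordering_C[of 0] by simp

text \<open>Closed under products because \<open>a * a\<close> is a square: the term quadratic in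
  \<open>a\<close> moves into the part that lies in \<open>P\<close>.\<close>

lemma preordering_adjoin: "preordering {p + a * q | p q. p \<in> P \<and> q \<in> P}"
  unfolding preordering_def
proof (intro conjI ballI allI)
  fix x y assume "x \<in> {p + a * q | p q. p \<in> P \<and> q \<in> P}" "y \<in> {p + a * q | p q. p \<in> P \<and> q \<in> P}"
  then obtain p q p' q' where xy: "x = p + a * q" "y = p' + a * q'"
    and mem: "p \<in> P" "q \<in> P" "p' \<in> P" "q' \<in> P" by blast
  have "x + y = (p + p') + a * (q + q')" by (simp add: xy algebra_simps)
  then show "x + y \<in> {p + a * q | p q. p \<in> P \<and> q \<in> P}" 
    using preordering_add[OF mem(1,3)] preordering_add[OF mem(2,4)] by blast
  have "x * y = (p * p' + (a * a) * (q * q')) + a * (p * q' + p' * q)"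
    by (simp add: xy algebra_simps)
  moreover have "p * p' + (a * a) * (q * q') \<in> P" "p * q' + p' * q \<in> P"
    by (intro preordering_add preordering_mult preordering_square mem)+
  ultimately show "x * y \<in> {p + a * q | p q. p \<in> P \<and> q \<in> P}" by blast
next
  fix b
  have "b * b = b * b + a * 0" by simp
  then show "b * b \<in> {p + a * q | p q. p \<in> P \<and> q \<in> P}" using preordering_square preordering_0 by blast
qed

lemma preordering_adjoin_superset: "P \<subseteq> {p + a * q | p q. p \<in> P \<and> q \<in> P}"
proof
  fix p assume "p \<in> P"
  moreover have "p = p + a * 0" by simp
  ultimately show "p \<in> {p + a * q | p q. p \<in> P \<and> q \<in> P}" using preordering_0 by blast
qed

lemma preordering_adjoin_mem: "a \<in> {p + a * q | p q. p \<in> P \<and> q \<in> P}"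
proof -
  have "a = 0 + a * 1" by simp
  then show ?thesis using preordering_0 preordering_1 by blast
qed

end

text \<open>Zorn's lemma gives a maximal proper preordering. If it contained neither
  \<open>a\<close> nor \<open>- a\<close>, then - 1 would be reached after adjoining either one, so
  \<open>a * q = - (1 + p)\<close> and \<open>a * q' = 1 + p'\<close>. Multiplying the two relations
  eliminates the sign of \<open>a\<close> and puts - 1 into \<open>P\<close> itself.\<close>

lemma maximal_preordering_exists:
  assumes "preordering T" "- 1 \<notin> T"
  obtains P where "preordering P" "T \<subseteq> P" "- 1 \<notin> P" "\<And>a. a \<in> P \<or> - a \<in> P"
proof -
  let ?A = "{P. preordering P \<and> T \<subseteq> P \<and> - 1 \<notin> P}"
  have "\<exists>M\<in>?A. \<forall>X\<in>?A. M \<subseteq> X \<longrightarrow> X = M"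
  proof (rule subset_Zorn_nonempty)
    show "?A \<noteq> {}" using assms by blast
    fix \<C> assume ne: "\<C> \<noteq> {}" and ch: "subset.chain ?A \<C>"
    have "preordering (\<Union>\<C>)"
      unfolding preordering_def
    proof (intro conjI ballI allI)
      fix a b assume "a \<in> \<Union>\<C>" "b \<in> \<Union>\<C>"
      then obtain X Y where "X \<in> \<C>" "a \<in> X" "Y \<in> \<C>" "b \<in> Y" by blast
      moreover have "X \<subseteq> Y \<or> Y \<subseteq> X" using ch calculation by (auto simp: subset.chain_def subset_chain_def)
      ultimately obtain Z where Z: "Z \<in> \<C>" "a \<in> Z" "b \<in> Z" by blast
      then have "preordering Z" using ch by (auto simp: subset_chain_def)
      then show "a + b \<in> \<Union>\<C>" "a * b \<in> \<Union>\<C>" using Z preordering_add preordering_mult by blast+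
    next
      fix a
      obtain X where X: "X \<in> \<C>" using ne by blast
      then have "preordering X" using ch by (auto simp: subset_chain_def)
      then show "a * a \<in> \<Union>\<C>" using X preordering_square by blast
    qed
    moreover have "T \<subseteq> \<Union>\<C>" "- 1 \<notin> \<Union>\<C>" using ne ch by (fastforce simp: subset_chain_def)+
    ultimately show "\<Union>\<C> \<in> ?A" by blast
  qed
  then obtain P where P: "preordering P" "T \<subseteq> P" "- 1 \<notin> P"
    and max: "\<And>X. preordering X \<Longrightarrow> - 1 \<notin> X \<Longrightarrow> P \<subseteq> X \<Longrightarrow> X = P"
    by (auto 0 4 dest: subset_trans)
  have "a \<in> P \<or> - a \<in> P" for a
  proof (rule ccontr)
    assume neg: "\<not> (a \<in> P \<or> - a \<in> P)"
    have *: "\<exists>p q. p \<in> P \<and> q \<in> P \<and> - 1 = p + b * q" if "b \<notin> P" for b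
      using max[OF preordering_adjoin[OF P(1), of b]] preordering_adjoin_superset[OF P(1), of b]
        preordering_adjoin_mem[OF P(1), of b] that by auto
    obtain p q p' q' where mem: "p \<in> P" "q \<in> P" "p' \<in> P" "q' \<in> P"
      and eq: "- 1 = p + a * q" "- 1 = p' + (- a) * q'"
      using *[of a] *[of "- a"] neg by blast
    have e: "a * q = - (1 + p)" "a * q' = 1 + p'"
      using eq by (metis add_diff_cancel_left' minus_add_distrib diff_conv_add_uminus add.commute)
        (metis eq(2) add_uminus_conv_diff diff_add_cancel add.commute mult_minus_left diff_minus_eq_add)
    have "(a * a) * (q * q') = (a * q) * (a * q')" by (simp add: algebra_simps)
    also have "\<dots> = - (1 + p) * (1 + p')" by (simp only: e)
    finally have "- 1 = (p + p' + p * p') + (a * a) * (q * q')"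
      by (simp add: algebra_simps)
    then show False
      using P mem by (metis preordering_add preordering_mult preordering_square)
  qed
  with P that show thesis by blast
qed

text \<open>
  A maximal archimedean preordering is a Dedekind cut in disguise: \<open>a\<close> is infinitely close to a
  unique real number, and this residue map is a homomorphism.
\<close>

lemma archimedean_total_preordering_hom:
  assumes P: "preordering P" "- 1 \<notin> P" and total: "\<And>a. a \<in> P \<or> - a \<in> P"
    and arch: "\<And>a. \<exists>k. C k - a \<in> P"
  obtains \<phi> :: "'a \<Rightarrow> real" where "\<And>a b. \<phi> (a + b) = \<phi> a + \<phi> b" "\<And>a b. \<phi> (a * b) = \<phi> a * \<phi> b"
    "\<And>x. \<phi> (C x) = x" "\<And>a. a \<in> P \<Longrightarrow> 0 \<le> \<phi> a"
proof -
  note add = preordering_add[OF P(1)] and mult = preordering_mult[OF P(1)]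
    and CP = preordering_C[OF P(1)]
  have C_iff: "C x \<in> P \<longleftrightarrow> 0 \<le> x" for x
  proof
    assume x: "C x \<in> P"
    show "0 \<le> x"
    proof (rule ccontr)
      assume neg: "\<not> 0 \<le> x"
      then have "C (- 1 / x) * C x \<in> P" using mult[OF CP x, of "- 1 / x"] by (simp add: divide_nonpos_neg)
      also have "C (- 1 / x) * C x = - 1" using neg by (simp add: C_mult[symmetric] C_minus)
      finally show False using P by simp
    qed
  qed (rule CP)
  \<comment> \<open>Infinitesimal elements. They form an ideal whose only constant is 0, so the
    residue of \<open>a\<close> is the unique \<open>x\<close> with \<open>a - C x\<close>
    infinitesimal.\<close>
  define near where "near a \<longleftrightarrow> (\<forall>\<epsilon>>0. C \<epsilon> + a \<in> P \<and> C \<epsilon> - a \<in> P)" for a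
  have near_add: "near (a + b)" if "near a" "near b" for a b
    unfolding near_def
  proof (intro allI impI)
    fix \<epsilon> :: real assume "\<epsilon> > 0"
    then have "C (\<epsilon>/2) + a \<in> P" "C (\<epsilon>/2) - a \<in> P" "C (\<epsilon>/2) + b \<in> P" "C (\<epsilon>/2) - b \<in> P"
      using that by (auto simp: near_def)
    then have "(C (\<epsilon>/2) + a) + (C (\<epsilon>/2) + b) \<in> P" "(C (\<epsilon>/2) - a) + (C (\<epsilon>/2) - b) \<in> P"
      using add by blast+
    moreover have "C \<epsilon> = C (\<epsilon>/2) + C (\<epsilon>/2)" by (simp add: C_add[symmetric])
    ultimately show "C \<epsilon> + (a + b) \<in> P \<and> C \<epsilon> - (a + b) \<in> P" by (simp add: algebra_simps)
  qed
  have near_uminus: "near (- a) \<longleftrightarrow> near a" for a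
    by (auto simp: near_def)
  have near_C: "near (C x) \<longleftrightarrow> x = 0" for x
  proof
    assume n: "near (C x)"
    have "\<bar>x\<bar> \<le> \<epsilon>" if "\<epsilon> > 0" for \<epsilon>
    proof -
      have "C (\<epsilon> + x) \<in> P" "C (\<epsilon> - x) \<in> P" using n that by (auto simp: near_def C_add C_diff)
      then show ?thesis by (auto simp: C_iff)
    qed
    from this[of "\<bar>x\<bar> / 2"] show "x = 0" by (cases "x = 0") auto
  qed (auto simp: near_def CP)
  \<comment> \<open>The archimedean hypothesis bounds \<open>v\<close> by a constant
    \<open>k \<ge> 1\<close>. With \<open>d = \<epsilon> / k\<close>, twice
    \<open>C \<epsilon> + u * v\<close> and twice \<open>C \<epsilon> - u * v\<close> are sums of
    products of the nonnegative elements \<open>C d + u\<close>, \<open>C d - u\<close>,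
    \<open>C k + v\<close>, \<open>C k - v\<close>.\<close>
  have near_mult: "near (u * v)" if u: "near u" for u v
    unfolding near_def
  proof (intro allI impI)
    fix \<epsilon> :: real assume eps: "\<epsilon> > 0"
    obtain k1 k2 where k12: "C k1 - v \<in> P" "C k2 - (- v) \<in> P" using arch by blast
    define k where "k = max 1 (max k1 k2)"
    have "C (k - k1) + (C k1 - v) \<in> P" "C (k - k2) + (C k2 - (- v)) \<in> P"
      using k12 by (auto simp: k_def intro!: add CP)
    then have kv: "C k - v \<in> P" "C k + v \<in> P"
      by (simp_all add: C_diff)
    define d where "d = \<epsilon> / k"
    have d: "d > 0" "d * k = \<epsilon>" using eps by (auto simp: d_def k_def)
    then have du: "C d + u \<in> P" "C d - u \<in> P" using u by (auto simp: near_def)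
    have half: "a \<in> P" if "a + a \<in> P" for a
    proof -
      have "a = (C (1/2) + C (1/2)) * a" by (simp add: C_add[symmetric])
      also have "\<dots> = C (1/2) * (a + a)" by (simp add: algebra_simps)
      finally show ?thesis using mult[OF CP[of "1/2"] that] by simp
    qed
    have eq: "C \<epsilon> = C d * C k" by (simp add: d C_mult[symmetric])
    have "(C d + u) * (C k + v) + (C d - u) * (C k - v) \<in> P"
      "(C d + u) * (C k - v) + (C d - u) * (C k + v) \<in> P"
      by (intro add mult du kv)+
    moreover have "(C \<epsilon> + u * v) + (C \<epsilon> + u * v) = (C d + u) * (C k + v) + (C d - u) * (C k - v)"
      "(C \<epsilon> - u * v) + (C \<epsilon> - u * v) = (C d + u) * (C k - v) + (C d - u) * (C k + v)"
      unfolding eq by (simp_all add: algebra_simps)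
    ultimately show "C \<epsilon> + u * v \<in> P \<and> C \<epsilon> - u * v \<in> P"
      using half by simp
  qed
  have unique: "x = y" if "near (a - C x)" "near (a - C y)" for a x y
  proof -
    have "near ((a - C x) + - (a - C y))" using that near_add near_uminus by blast
    then show ?thesis using near_C[of "y - x"] by (simp add: C_diff)
  qed
  have ex: "\<exists>x. near (a - C x)" for a
  proof -
    \<comment> \<open>The lower part of the cut that \<open>a\<close> makes in the reals. The
      archimedean bounds make it nonempty and bounded above, and its supremum is the
      residue.\<close>
    define S where "S = {q. a - C q \<in> P}"
    obtain k1 where k1: "C k1 - a \<in> P" using arch by blast
    obtain k2 where k2: "C k2 - (- a) \<in> P" using arch by blast
    have bound: "q \<le> q'" if "a - C q \<in> P" "C q' - a \<in> P" for q q'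
    proof -
      have "C (q' - q) \<in> P" using add[OF that] by (simp add: C_diff algebra_simps)
      then show ?thesis by (simp add: C_iff)
    qed
    have "- k2 \<in> S" using k2 by (simp add: S_def C_minus add.commute)
    then have ne: "S \<noteq> {}" by blast
    have bdd: "bdd_above S" using bound[OF _ k1] by (auto simp: S_def bdd_above_def)
    have "near (a - C (Sup S))"
      unfolding near_def
    proof (intro allI impI)
      fix \<epsilon> :: real assume eps: "\<epsilon> > 0"
      obtain q where q: "q \<in> S" "Sup S - \<epsilon> < q"
        using less_cSup_iff[OF ne bdd, of "Sup S - \<epsilon>"] eps by auto
      have "C (q - (Sup S - \<epsilon>)) + (a - C q) \<in> P" using q by (intro add CP) (simp_all add: S_def)
      then have 1: "C \<epsilon> + (a - C (Sup S)) \<in> P" by (simp add: C_diff add_diff_eq)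
      have "Sup S + \<epsilon> \<notin> S" using cSup_upper[OF _ bdd] eps by fastforce
      \<comment> \<open>Totality turns the failure of membership above the supremum into the upper
        estimate.\<close>
      then have "- (a - C (Sup S + \<epsilon>)) \<in> P" using total unfolding S_def by blast
      then have 2: "C \<epsilon> - (a - C (Sup S)) \<in> P" by (simp add: C_add algebra_simps)
      from 1 2 show "C \<epsilon> + (a - C (Sup S)) \<in> P \<and> C \<epsilon> - (a - C (Sup S)) \<in> P" ..
    qed
    then show ?thesis ..
  qed
  define \<phi> where "\<phi> a = (SOME x. near (a - C x))" for a
  have \<phi>: "near (a - C (\<phi> a))" for a unfolding \<phi>_def using ex by (rule someI_ex)
  have eqI: "\<phi> a = x" if "near (a - C x)" for a x using unique[OF \<phi> that] .
  show thesis
  proof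
    fix a b
    have "near ((a - C (\<phi> a)) + (b - C (\<phi> b)))" using \<phi> near_add by blast
    then show "\<phi> (a + b) = \<phi> a + \<phi> b" by (intro eqI) (simp add: C_add algebra_simps)
    \<comment> \<open>The sum telescopes to
      \<open>a * b - C (\<phi> a) * C (\<phi> b)\<close>.\<close>
    have "near ((a - C (\<phi> a)) * b + (b - C (\<phi> b)) * C (\<phi> a))" using \<phi> near_add near_mult by blast
    then show "\<phi> (a * b) = \<phi> a * \<phi> b" by (intro eqI) (simp add: C_mult algebra_simps)
  next
    show "\<phi> (C x) = x" for x by (rule eqI) (simp add: near_C[of 0, simplified])
  next
    fix a assume a: "a \<in> P"
    have "0 \<le> \<phi> a + \<epsilon>" if "\<epsilon> > 0" for \<epsilon>
    proof -
      have "C \<epsilon> - (a - C (\<phi> a)) \<in> P" using \<phi> that unfolding near_def by blast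
      from add[OF this a] have "(C \<epsilon> - (a - C (\<phi> a))) + a \<in> P" .
      then have "C (\<phi> a + \<epsilon>) \<in> P" by (simp add: C_add algebra_simps)
      then show ?thesis by (simp add: C_iff)
    qed
    then show "0 \<le> \<phi> a" by (rule field_le_epsilon)
  qed
qed

text \<open>Two stages. If no identity \<open>f * t = 1 + s\<close> existed, \<open>- f\<close>
  could be adjoined without reaching - 1, and the residue map of a maximal extension would be
  nonpositive at \<open>f\<close>. The factor \<open>t\<close> is then removed by a descent: some
  \<open>f + C r\<close> lies in \<open>T\<close> by the archimedean property, and \<open>r\<close>
  can be lowered by the fixed amount \<open>1 / k\<close>, where \<open>k\<close> bounds
  \<open>t\<close>.\<close>

theorem archimedean_positivstellensatz:
  assumes T: "preordering T" and arch: "\<And>a. \<exists>k. C k - a \<in> T"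
    and pos: "\<And>\<phi> :: 'a \<Rightarrow> real. (\<And>a b. \<phi> (a + b) = \<phi> a + \<phi> b) \<Longrightarrow> (\<And>a b. \<phi> (a * b) = \<phi> a * \<phi> b) \<Longrightarrow>
      (\<And>x. \<phi> (C x) = x) \<Longrightarrow> (\<And>a. a \<in> T \<Longrightarrow> 0 \<le> \<phi> a) \<Longrightarrow> 0 < \<phi> f"
  shows "f \<in> T"
proof -
  note add = preordering_add[OF T] and mult = preordering_mult[OF T]
    and CT = preordering_C[OF T]
  have "\<exists>t s. t \<in> T \<and> s \<in> T \<and> f * t = 1 + s"
  proof (rule ccontr)
    assume no: "\<not> ?thesis"
    let ?T = "{s + (- f) * t | s t. s \<in> T \<and> t \<in> T}"
    have "- 1 \<notin> ?T"
    proof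
      assume "- 1 \<in> ?T"
      then obtain s t where "s \<in> T" "t \<in> T" "- 1 = s + (- f) * t" by blast
      then have "f * t = 1 + s" by (simp add: algebra_simps eq_neg_iff_add_eq_0)
      with no \<open>s \<in> T\<close> \<open>t \<in> T\<close> show False by blast
    qed
    then obtain P where P: "preordering P" "?T \<subseteq> P" "- 1 \<notin> P" "\<And>a. a \<in> P \<or> - a \<in> P"
      by (rule maximal_preordering_exists[OF preordering_adjoin[OF T], of "- f"]) blast
    have TP: "T \<subseteq> P" "- f \<in> P"
      using preordering_adjoin_superset[OF T, of "- f"] preordering_adjoin_mem[OF T, of "- f"] P(2)
      by auto
    have archP: "\<exists>k. C k - a \<in> P" for a using arch TP by blast
    obtain \<phi> :: "'a \<Rightarrow> real" where \<phi>: "\<And>a b. \<phi> (a + b) = \<phi> a + \<phi> b" "\<And>a b. \<phi> (a * b) = \<phi> a * \<phi> b"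
      "\<And>x. \<phi> (C x) = x" "\<And>a. a \<in> P \<Longrightarrow> 0 \<le> \<phi> a"
      by (rule archimedean_total_preordering_hom[OF P(1) P(3) P(4) archP]) blast
    have "0 < \<phi> f" using pos[OF \<phi>(1-3)] \<phi>(4) TP by blast
    moreover have "\<phi> f + \<phi> (- f) = 0" using \<phi>(1)[of f "- f"] \<phi>(3)[of 0] by simp
    ultimately show False using \<phi>(4)[OF TP(2)] by simp
  qed
  then obtain t s where ts: "t \<in> T" "s \<in> T" "f * t = 1 + s" by blast
  obtain k0 where "C k0 - t \<in> T" using arch by blast
  define k where "k = max 1 k0"
  have kt: "C k - t \<in> T"
  proof -
    have "C k - t = C (k - k0) + (C k0 - t)" by (simp add: C_diff)
    moreover have "k - k0 \<ge> 0" by (simp add: k_def)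
    ultimately show ?thesis using add[OF CT \<open>C k0 - t \<in> T\<close>] by metis
  qed
  have k: "k > 0" by (simp add: k_def)
  \<comment> \<open>Since \<open>(k - t)\<^sup>2 = k\<^sup>2 - t * (2 * k - t)\<close>, the
    correction terms complete \<open>(k - t)\<^sup>2 * (f + r)\<close> to
    \<open>k\<^sup>2 * (f + r) - k\<close> once \<open>s = f * t - 1\<close> is inserted; every
    summand used lies in \<open>T\<close>.\<close>
  have step: "f + C (r - 1/k) \<in> T" if r: "0 \<le> r" "f + C r \<in> T" for r
  proof -
    have kkt: "C k + (C k - t) \<in> T" using add[OF CT kt, of k] k by simp
    have "(C k - t) * (C k - t) * (f + C r) + (C k - t) + (C k + (C k - t)) * s
        + C r * t * (C k + (C k - t)) \<in> T"
      using kt kkt r ts CT[OF r(1)] add mult by simp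
    also have "(C k - t) * (C k - t) * (f + C r) + (C k - t) + (C k + (C k - t)) * s
        + C r * t * (C k + (C k - t)) = C k * C k * (f + C r) - C k"
    proof -
      have s: "s = f * t - 1" using ts(3) by simp
      show ?thesis unfolding s by (simp add: algebra_simps)
    qed
    finally have "C (1 / k\<^sup>2) * (C k * C k * (f + C r) - C k) \<in> T"
      using mult[OF CT[of "1 / k\<^sup>2"]] by simp
    also have "C (1 / k\<^sup>2) * (C k * C k * (f + C r) - C k) = C (1 / k\<^sup>2 * k * k) * (f + C r) - C (1 / k\<^sup>2 * k)"
      by (simp only: C_mult algebra_simps)
    finally have "C (1 / k\<^sup>2 * k * k) * (f + C r) - C (1 / k\<^sup>2 * k) \<in> T" .
    moreover have "1 / k\<^sup>2 * k * k = 1" "1 / k\<^sup>2 * k = 1 / k" using k by (simp_all add: power2_eq_square)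
    ultimately show ?thesis by (simp add: C_diff algebra_simps)
  qed
  obtain r0 where r0: "C r0 - (- f) \<in> T" using arch by blast
  \<comment> \<open>The descent step needs a nonnegative constant. Once the constant is negative,
    adding its opposite shows \<open>f \<in> T\<close>, whence the disjunction.\<close>
  have *: "f \<in> T \<or> f + C (r0 - real j / k) \<in> T" for j
  proof (induction j)
    case 0
    then show ?case using r0 by (simp add: add.commute)
  next
    case (Suc j)
    show ?case
    proof (cases "f \<in> T \<or> r0 - real j / k < 0")
      case True
      have "f \<in> T" if "r < 0" "f + C r \<in> T" for r
        using add[OF that(2) CT[of "- r"]] that(1) by (simp add: C_minus)
      then show ?thesis using True Suc by blast
    next
      case False
      then have "f + C (r0 - real j / k - 1 / k) \<in> T" using Suc step by simp
      then show ?thesis by (simp add: add_divide_distrib diff_diff_eq add.commute)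
    qed
  qed
  obtain j :: nat where j: "r0 * k \<le> real j" using real_arch_simple by blast
  then have "0 \<le> real j / k - r0" using k by (simp add: field_simps)
  from CT[OF this] *[of j] show ?thesis
    using add[of "f + C (r0 - real j / k)" "C (real j / k - r0)"] by (auto simp: C_diff)
qed

end

section \<open>Homogenization modulo the Pluecker ideal\<close>

interpretation ideal: module "(*) :: 'a::comm_ring_1 \<Rightarrow> 'a \<Rightarrow> 'a"
  by unfold_locales (simp_all add: algebra_simps)

\<comment> \<open>as a simp rule it loops with \<open>mult.assoc\<close>\<close>
declare ideal.scale_scale [simp del]

interpretation mconst: real_scalars "mconst :: real \<Rightarrow> 'v mpoly"
  by unfold_locales (simp_all add: mconst_def single_add mult_single)

text \<open>The parameter \<open>Q\<close> restricts the elements that are squared: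
  \<open>UNIV\<close> for the inhomogeneous certificate, the forms of one degree for the final
  one.\<close>

inductive_set sos :: "'a::comm_ring_1 set \<Rightarrow> 'a set" for Q where
  sos_zero: "0 \<in> sos Q"
| sos_add_square: "x \<in> sos Q \<Longrightarrow> q \<in> Q \<Longrightarrow> x + q ^ 2 \<in> sos Q"

lemma sos_square: "q \<in> Q \<Longrightarrow> q ^ 2 \<in> sos Q"
  using sos_add_square[OF sos_zero] by fastforce

lemma sos_add: "y \<in> sos Q \<Longrightarrow> x \<in> sos Q \<Longrightarrow> x + y \<in> sos Q"
  by (induction y rule: sos.induct) (auto simp: add.assoc[symmetric] intro: sos.intros)

lemma sos_sum: "(\<And>i. i \<in> I \<Longrightarrow> f i \<in> sos Q) \<Longrightarrow> sum f I \<in> sos Q"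
  by (induction I rule: infinite_finite_induct) (auto intro: sos_zero sos_add)

lemma sos_mult:
  assumes Q: "\<And>p q. p \<in> Q \<Longrightarrow> q \<in> Q \<Longrightarrow> p * q \<in> Q" and y: "y \<in> sos Q" and x: "x \<in> sos Q"
  shows "x * y \<in> sos Q"
  using y
proof induction
  case (sos_add_square y q)
  have "x * q ^ 2 \<in> sos Q"
    using x
  proof induction
    case (sos_add_square x p)
    then have "x * q ^ 2 + (p * q) ^ 2 \<in> sos Q"
      using Q \<open>q \<in> Q\<close> by (intro sos.sos_add_square) auto
    then show ?case by (simp add: algebra_simps)
  qed (auto intro: sos_zero)
  then show ?case using sos_add_square sos_add by (simp add: distrib_left)
qed (auto intro: sos_zero)

lemma sos_eq_sum: "x \<in> sos Q \<Longrightarrow> \<exists>(N::nat) q. (\<forall>k<N. q k \<in> Q) \<and> x = (\<Sum>k<N. q k ^ 2)"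
proof (induction rule: sos.induct)
  case (sos_add_square x p)
  then obtain N q where q: "\<forall>k<N::nat. q k \<in> Q" "x = (\<Sum>k<N. q k ^ 2)" by blast
  have "\<forall>k<Suc N. (q(N := p)) k \<in> Q" using q sos_add_square by (simp add: less_Suc_eq)
  moreover have "x + p ^ 2 = (\<Sum>k<Suc N. (q(N := p)) k ^ 2)" using q by simp
  ultimately show ?case by blast
qed (use lessThan_0 in \<open>auto intro!: exI[of _ 0]\<close>)

definition wt :: "('v \<Rightarrow>\<^sub>0 nat) \<Rightarrow> nat" where
  "wt e = (\<Sum>v\<in>Poly_Mapping.keys e. Poly_Mapping.lookup e v)"

lemma wt_add: "wt (e + e') = wt e + wt e'"
  unfolding wt_def by (rule setsum_keys_plus_distrib) auto

lemma wt_0 [simp]: "wt 0 = 0"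
  and wt_single [simp]: "wt (Poly_Mapping.single v n) = n"
  by (simp_all add: wt_def)

lemma homogeneous_iff: "homogeneous d p \<longleftrightarrow> (\<forall>e\<in>Poly_Mapping.keys p. wt e = d)"
  by (simp add: homogeneous_def wt_def)

text \<open>The set \<open>S\<close> carries a bound on the monomials through the induction, such as
  a fixed degree or a maximal weight.\<close>

lemma mpoly_keys_induct [consumes 1, case_names zero single add]:
  fixes p :: "'v mpoly"
  assumes "Poly_Mapping.keys p \<subseteq> S" "P 0" "\<And>e a. e \<in> S \<Longrightarrow> P (Poly_Mapping.single e a)"
    and "\<And>p q. P p \<Longrightarrow> P q \<Longrightarrow> P (p + q)"
  shows "P p"
proof -
  have "P (\<Sum>e\<in>E. Poly_Mapping.single e (Poly_Mapping.lookup p e))" if "finite E" "E \<subseteq> S" for E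
    using that assms(2-4) by (induction E) auto
  moreover have "p = (\<Sum>e\<in>Poly_Mapping.keys p. Poly_Mapping.single e (Poly_Mapping.lookup p e))"
    by (rule poly_mapping_eqI) (auto simp: lookup_sum lookup_single when_def in_keys_iff)
  ultimately show ?thesis using assms(1) by (metis finite_keys)
qed

lemma homogeneous_induct [consumes 1, case_names zero single add]:
  fixes p :: "'v mpoly"
  assumes "homogeneous d p" "P 0" "\<And>e a. wt e = d \<Longrightarrow> P (Poly_Mapping.single e a)"
    and "\<And>p q. P p \<Longrightarrow> P q \<Longrightarrow> P (p + q)"
  shows "P p"
  using assms by (intro mpoly_keys_induct[of p "{e. wt e = d}" P]) (auto simp: homogeneous_iff)

lemma single_eq_mconst_mult: "Poly_Mapping.single e a = mconst a * Poly_Mapping.single e 1"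
  by (simp add: mconst_def mult_single)

lemma single_add_1: "Poly_Mapping.single (e + e') (1 :: real) = Poly_Mapping.single e 1 * Poly_Mapping.single e' 1"
  by (simp add: mult_single)

text \<open>Generation of the polynomial ring as an algebra, for properties that pass to products,
  such as boundedness by constants or differentiability.\<close>

lemma mpoly_gen_induct [case_names const var add mult]:
  fixes p :: "'v mpoly"
  assumes const: "\<And>a. P (mconst a)" and var: "\<And>v. P (mvar v)"
    and add: "\<And>p q. P p \<Longrightarrow> P q \<Longrightarrow> P (p + q)" and mult: "\<And>p q. P p \<Longrightarrow> P q \<Longrightarrow> P (p * q)"
  shows "P p"
proof -
  have one: "P 1" using const[of 1] by simp
  have v: "P (Poly_Mapping.single (Poly_Mapping.single v n) 1)" for v n
  proof (induction n)
    case (Suc n)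
    have "Poly_Mapping.single v (Suc n) = Poly_Mapping.single v 1 + Poly_Mapping.single v n"
      by (simp add: single_add[symmetric])
    then show ?case using Suc mult[OF var[of v]] by (simp add: single_add_1 mvar_def)
  qed (use one in simp)
  have mon: "P (Poly_Mapping.single e 1)" for e :: "'v \<Rightarrow>\<^sub>0 nat"
  proof -
    have "P (Poly_Mapping.single (\<Sum>v\<in>E. Poly_Mapping.single v (Poly_Mapping.lookup e v)) 1)"
      if "finite E" for E
      using that
    proof (induction E)
      case (insert w E)
      then show ?case using mult[OF v] by (simp add: single_add_1)
    qed (use one in simp)
    moreover have "e = (\<Sum>v\<in>Poly_Mapping.keys e. Poly_Mapping.single v (Poly_Mapping.lookup e v))"
      by (rule poly_mapping_eqI) (auto simp: lookup_sum lookup_single when_def in_keys_iff)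
    ultimately show ?thesis by (metis finite_keys)
  qed
  have "P (Poly_Mapping.single e a)" for e a
    using mult[OF const mon] by (simp add: single_eq_mconst_mult[of e a])
  then show ?thesis
    using const[of 0] add by (intro mpoly_keys_induct[of p UNIV P]) (auto simp: mconst_def)
qed

lemma homogeneous_0 [simp]: "homogeneous d 0"
  and homogeneous_1 [simp]: "homogeneous 0 1"
  and homogeneous_mconst [simp]: "homogeneous 0 (mconst a)"
  and homogeneous_mvar [simp]: "homogeneous 1 (mvar v)"
  by (auto simp: homogeneous_iff mconst_def mvar_def)

lemma homogeneous_single: "wt e = d \<Longrightarrow> homogeneous d (Poly_Mapping.single e a)"
  by (auto simp: homogeneous_iff)

lemma homogeneous_add: "homogeneous d p \<Longrightarrow> homogeneous d q \<Longrightarrow> homogeneous d (p + q)"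
  using keys_add[of p q] by (auto simp: homogeneous_iff)

lemma homogeneous_mult: "homogeneous d p \<Longrightarrow> homogeneous d' q \<Longrightarrow> homogeneous (d + d') (p * q)"
  using keys_mult[of p q] by (fastforce simp: homogeneous_iff wt_add)

lemma homogeneous_mconst_mult: "homogeneous d p \<Longrightarrow> homogeneous d (mconst a * p)"
  using homogeneous_mult[OF homogeneous_mconst] by fastforce

lemma homogeneous_uminus: "homogeneous d p \<Longrightarrow> homogeneous d (- p)"
  by (auto simp: homogeneous_iff in_keys_iff)

lemma homogeneous_diff: "homogeneous d p \<Longrightarrow> homogeneous d q \<Longrightarrow> homogeneous d (p - q)"
  using homogeneous_add[OF _ homogeneous_uminus] by fastforce

lemma homogeneous_sum: "(\<And>i. i \<in> I \<Longrightarrow> homogeneous d (f i)) \<Longrightarrow> homogeneous d (sum f I)"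
  by (induction I rule: infinite_finite_induct) (auto intro: homogeneous_add)

lemma homogeneous_power: "homogeneous d p \<Longrightarrow> homogeneous (d * k) (p ^ k)"
  by (induction k) (auto intro: homogeneous_mult)

lemma homogeneous_r_poly: "homogeneous 2 r_poly"
  unfolding r_poly_def using homogeneous_power[OF homogeneous_mvar, of 2] by (intro homogeneous_sum) simp

lemma homogeneous_quadratic_poly: "homogeneous 2 (quadratic_poly R)"
  unfolding quadratic_poly_def one_add_one[symmetric]
  by (intro homogeneous_sum homogeneous_mult homogeneous_mconst_mult homogeneous_mvar)

lemma homogeneous_pluecker: "g \<in> pluecker_relations \<Longrightarrow> homogeneous 2 g"
  using homogeneous_mult[OF homogeneous_mvar homogeneous_mvar]
  unfolding pluecker_relations_def pvar_def
  by (auto simp: numeral_2_eq_2 intro!: homogeneous_add homogeneous_diff)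

text \<open>
  \<open>homogenize M\<close> is the substitution \<open>x \<mapsto> x / \<surd>r\<close> multiplied by \<open>\<surd>r ^ M\<close>, restricted to the
  terms that are free of \<open>\<surd>r\<close>.
\<close>

definition homog_monomial :: "nat \<Rightarrow> (('n::{finite,linorder}) biv_index \<Rightarrow>\<^sub>0 nat) \<Rightarrow> 'n biv_index mpoly" where
  "homog_monomial M e = (if wt e \<le> M \<and> even (M - wt e)
     then r_poly ^ ((M - wt e) div 2) * Poly_Mapping.single e 1 else 0)"

definition homogenize :: "nat \<Rightarrow> ('n::{finite,linorder}) biv_index mpoly \<Rightarrow> 'n biv_index mpoly" where
  "homogenize M p = (\<Sum>e\<in>Poly_Mapping.keys p. mconst (Poly_Mapping.lookup p e) * homog_monomial M e)"

lemma homog_monomial_even: "homog_monomial (wt e + 2 * a) e = r_poly ^ a * Poly_Mapping.single e 1"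
  by (simp add: homog_monomial_def)

lemma homog_monomial_eq_0: "N < wt e \<or> odd (N - wt e) \<Longrightarrow> homog_monomial N e = 0"
  by (auto simp: homog_monomial_def)

lemma homogenize_0 [simp]: "homogenize M 0 = 0"
  by (simp add: homogenize_def)

lemma homogenize_single: "homogenize M (Poly_Mapping.single e a) = mconst a * homog_monomial M e"
  by (auto simp: homogenize_def)

lemma homogenize_add: "homogenize M (p + q) = homogenize M p + homogenize M q"
  unfolding homogenize_def
  by (rule setsum_keys_plus_distrib) (auto simp: mconst.C_add distrib_right)

lemma homogenize_diff: "homogenize M (p - q) = homogenize M p - homogenize M q"
  using homogenize_add[of M "p - q" q] by simp

lemma homogeneous_homogenize: "homogeneous M (homogenize M p)"
proof -
  have "homogeneous M (homog_monomial M e)" for e :: "'n::{finite,linorder} biv_index \<Rightarrow>\<^sub>0 nat"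
  proof (cases "wt e \<le> M \<and> even (M - wt e)")
    case True
    then have M: "2 * ((M - wt e) div 2) + wt e = M" by auto
    have "homogeneous (2 * ((M - wt e) div 2) + wt e)
        (r_poly ^ ((M - wt e) div 2) * Poly_Mapping.single e 1)"
      by (intro homogeneous_mult homogeneous_power homogeneous_r_poly homogeneous_single refl)
    then show ?thesis using True unfolding M by (simp add: homog_monomial_def)
  qed (auto simp: homog_monomial_def)
  then show ?thesis unfolding homogenize_def by (intro homogeneous_sum homogeneous_mconst_mult)
qed

lemma homogenize_mult_quadratic:
  assumes "homogeneous 2 g" "2 \<le> M"
  shows "homogenize M (p * g) = homogenize (M - 2) p * g"
proof -
  have "\<forall>p. homogenize M (p * g) = homogenize (M - 2) p * g"
    using assms(1)
  proof (induction g rule: homogeneous_induct)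
    case (single e a)
    show ?case
    proof
      fix p
      show "homogenize M (p * Poly_Mapping.single e a) = homogenize (M - 2) p * Poly_Mapping.single e a"
      proof (induction p rule: mpoly_keys_induct[OF subset_UNIV])
        case (2 e' b)
        have m: "homog_monomial M (e' + e) = homog_monomial (M - 2) e' * Poly_Mapping.single e 1"
        proof -
          have "wt (e' + e) \<le> M \<longleftrightarrow> wt e' \<le> M - 2" "M - wt (e' + e) = M - 2 - wt e'"
            using single assms(2) by (auto simp: wt_add)
          then show ?thesis
            unfolding homog_monomial_def single_add_1 by (simp only: mult.assoc mult_zero_left split: if_split) blast
        qed
        show ?case
          unfolding mult_single homogenize_single m mconst.C_mult
          by (simp only: single_eq_mconst_mult[of e a] mult_ac)
      qed (simp_all add: homogenize_add distrib_right)
    qed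
  qed (simp_all add: homogenize_add distrib_left)
  then show ?thesis ..
qed

text \<open>Homogenizing in a degree larger by 2 costs one more factor \<open>r_poly\<close>;
  together with the preceding rule this makes multiples of \<open>r_poly - 1\<close> vanish. The
  weight bound matters: a monomial of weight \<open>M \<ge> 2\<close> would give 0 on the left but
  survive on the right.\<close>

lemma homogenize_raise:
  assumes "\<And>e. e \<in> Poly_Mapping.keys p \<Longrightarrow> wt e + 2 \<le> M"
  shows "homogenize (M - 2) p * r_poly = homogenize M p"
proof -
  have "homog_monomial (M - 2) e * r_poly = homog_monomial M e" if e: "wt e + 2 \<le> M" for e :: "'a biv_index \<Rightarrow>\<^sub>0 nat"
  proof -
    obtain k where M: "M = wt e + 2 + k" using le_Suc_ex[OF e] by blast
    show ?thesis
    proof (cases "even k")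
      case True
      then obtain a where "k = 2 * a" by blast
      then have "M - 2 = wt e + 2 * a" "M = wt e + 2 * Suc a" using M by auto
      then have "homog_monomial (M - 2) e = r_poly ^ a * Poly_Mapping.single e 1"
        "homog_monomial M e = r_poly ^ Suc a * Poly_Mapping.single e 1"
        using homog_monomial_even by metis+
      then show ?thesis by (simp only: power_Suc mult_ac)
    next
      case False
      then have "homog_monomial (M - 2) e = 0" "homog_monomial M e = 0"
        using M by (auto intro!: homog_monomial_eq_0)
      then show ?thesis by simp
    qed
  qed
  then show ?thesis
    using assms by (auto simp: homogenize_def sum_distrib_right mult.assoc intro!: sum.cong)
qed

text \<open>The full substitution sends \<open>p\<close> to A + B sqrt(r), where A is
  \<open>homogenize M p\<close> and B is \<open>homogenize (M - 1) p\<close>. It is multiplicative,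
  and the part of (A + B sqrt(r)) (A' + B' sqrt(r)) free of the root is A A' + r B B'. The parity
  cases for monomials are the four products; \<open>1 \<le> M\<close> keeps \<open>M - 1\<close>
  from being truncated.\<close>

lemma homogenize_mult:
  assumes p: "\<And>e. e \<in> Poly_Mapping.keys p \<Longrightarrow> wt e \<le> M" and q: "\<And>e. e \<in> Poly_Mapping.keys q \<Longrightarrow> wt e \<le> M"
    and M: "1 \<le> M"
  shows "homogenize (2 * M) (p * q) =
    homogenize M p * homogenize M q + r_poly * (homogenize (M - 1) p * homogenize (M - 1) q)"
proof -
  have mon: "homog_monomial (2 * M) (e + e') = homog_monomial M e * homog_monomial M e' +
      r_poly * (homog_monomial (M - 1) e * homog_monomial (M - 1) e')"
    if e: "wt e \<le> M" "wt e' \<le> M" for e e' :: "'a biv_index \<Rightarrow>\<^sub>0 nat"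
  proof -
    obtain k k' where k: "M = wt e + k" "M = wt e' + k'" using e le_Suc_ex by metis
    show ?thesis
    proof (cases "even k")
      case True
      then obtain a where a: "k = 2 * a" by blast
      have z: "homog_monomial (M - 1) e = 0" using a k(1) M by (intro homog_monomial_eq_0) (cases a; auto)
      have 1: "homog_monomial M e = r_poly ^ a * Poly_Mapping.single e 1" using homog_monomial_even[of e a] k(1) a by simp
      show ?thesis
      proof (cases "even k'")
        case True
        then obtain b where b: "k' = 2 * b" by blast
        have 2: "homog_monomial M e' = r_poly ^ b * Poly_Mapping.single e' 1" using homog_monomial_even[of e' b] k(2) b by simp
        have "2 * M = wt (e + e') + 2 * (a + b)" using k a b by (simp add: wt_add)
        then have "homog_monomial (2 * M) (e + e') = r_poly ^ (a + b) * Poly_Mapping.single (e + e') 1"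
          using homog_monomial_even by metis
        then show ?thesis unfolding z 1 2 single_add_1 power_add
            by (simp only: mult_zero_left mult_zero_right add_0_left add_0_right mult_ac)
      next
        case False
        then have "homog_monomial M e' = 0" using k(2) by (intro homog_monomial_eq_0) auto
        moreover have "homog_monomial (2 * M) (e + e') = 0"
        proof -
          have "2 * M - wt (e + e') = k + k'" using k by (simp add: wt_add)
          then show ?thesis using True False by (intro homog_monomial_eq_0) auto
        qed
        ultimately show ?thesis using z by simp
      qed
    next
      case False
      then obtain a where a: "k = 2 * a + 1" by (elim oddE)
      have z: "homog_monomial M e = 0" using False k(1) by (intro homog_monomial_eq_0) auto
      have 1: "homog_monomial (M - 1) e = r_poly ^ a * Poly_Mapping.single e 1" using homog_monomial_even[of e a] k(1) a by simp
      show ?thesis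
      proof (cases "odd k'")
        case True
        then obtain b where b: "k' = 2 * b + 1" by (elim oddE)
        have 2: "homog_monomial (M - 1) e' = r_poly ^ b * Poly_Mapping.single e' 1" using homog_monomial_even[of e' b] k(2) b by simp
        have "2 * M = wt (e + e') + 2 * (a + b + 1)" using k a b by (simp add: wt_add)
        then have "homog_monomial (2 * M) (e + e') = r_poly ^ (a + b + 1) * Poly_Mapping.single (e + e') 1"
          using homog_monomial_even by metis
        then show ?thesis unfolding z 1 2 single_add_1 power_add power_one_right
            by (simp only: mult_zero_left mult_zero_right add_0_left add_0_right mult_ac)
      next
        case even': False
        then have "homog_monomial (M - 1) e' = 0" using k(2) M by (intro homog_monomial_eq_0) (cases "k' = 0"; auto)
        moreover have "homog_monomial (2 * M) (e + e') = 0"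
        proof -
          have "2 * M - wt (e + e') = k + k'" using k by (simp add: wt_add)
          then show ?thesis using False even' by (intro homog_monomial_eq_0) auto
        qed
        ultimately show ?thesis using z by simp
      qed
    qed
  qed
  have "\<forall>q. Poly_Mapping.keys q \<subseteq> {e. wt e \<le> M} \<longrightarrow> homogenize (2 * M) (p * q) =
    homogenize M p * homogenize M q + r_poly * (homogenize (M - 1) p * homogenize (M - 1) q)"
  proof (rule mpoly_keys_induct[of p "{e. wt e \<le> M}"])
    fix e and a :: real assume e: "e \<in> {e :: 'a biv_index \<Rightarrow>\<^sub>0 nat. wt e \<le> M}"
    let ?p = "Poly_Mapping.single e a"
    show "\<forall>q. Poly_Mapping.keys q \<subseteq> {e. wt e \<le> M} \<longrightarrow> homogenize (2 * M) (?p * q) =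
      homogenize M ?p * homogenize M q + r_poly * (homogenize (M - 1) ?p * homogenize (M - 1) q)"
    proof (intro allI impI)
      fix q :: "'a biv_index mpoly" assume "Poly_Mapping.keys q \<subseteq> {e :: 'a biv_index \<Rightarrow>\<^sub>0 nat. wt e \<le> M}"
      then show "homogenize (2 * M) (?p * q) =
        homogenize M ?p * homogenize M q + r_poly * (homogenize (M - 1) ?p * homogenize (M - 1) q)"
      proof (induction q rule: mpoly_keys_induct)
        case (single e' b)
        then have m: "homog_monomial (2 * M) (e + e') = homog_monomial M e * homog_monomial M e' +
            r_poly * (homog_monomial (M - 1) e * homog_monomial (M - 1) e')"
          using e by (intro mon) simp_all
        show ?case
          unfolding mult_single homogenize_single mconst.C_mult m by (simp only: distrib_left mult_ac)
      next
        case (add q q')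
        then show ?case by (simp only: homogenize_add distrib_left distrib_right add_ac)
      qed simp
    qed
  next
    fix p p' :: "'a biv_index mpoly"
    assume IH: "\<forall>q. Poly_Mapping.keys q \<subseteq> {e. wt e \<le> M} \<longrightarrow> homogenize (2 * M) (p * q) =
        homogenize M p * homogenize M q + r_poly * (homogenize (M - 1) p * homogenize (M - 1) q)"
      "\<forall>q. Poly_Mapping.keys q \<subseteq> {e. wt e \<le> M} \<longrightarrow> homogenize (2 * M) (p' * q) =
        homogenize M p' * homogenize M q + r_poly * (homogenize (M - 1) p' * homogenize (M - 1) q)"
    show "\<forall>q. Poly_Mapping.keys q \<subseteq> {e. wt e \<le> M} \<longrightarrow> homogenize (2 * M) ((p + p') * q) =
        homogenize M (p + p') * homogenize M q + r_poly * (homogenize (M - 1) (p + p') * homogenize (M - 1) q)"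
    proof (intro allI impI)
      fix q :: "'a biv_index mpoly" assume "Poly_Mapping.keys q \<subseteq> {e. wt e \<le> M}"
      note IH[rule_format, OF this]
      then show "homogenize (2 * M) ((p + p') * q) =
        homogenize M (p + p') * homogenize M q + r_poly * (homogenize (M - 1) (p + p') * homogenize (M - 1) q)"
        by (simp only: homogenize_add distrib_left distrib_right add_ac)
    qed
  qed (use p in auto)
  then show ?thesis using q by auto
qed

lemma weight_bound: "\<exists>M0. \<forall>e\<in>Poly_Mapping.keys p. wt e \<le> M0"
  using finite_nat_set_iff_bounded_le[of "wt ` Poly_Mapping.keys p"] by simp

text \<open>A square becomes A^2 + r B^2, and r B^2 is the sum of the squares of
  \<open>mvar v\<close> times B, which are again forms of degree \<open>M\<close>.\<close>

lemma homogenize_sos: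
  assumes "s \<in> sos UNIV"
  shows "\<exists>M0. \<forall>M\<ge>M0. homogenize (2 * M) s \<in> sos {q. homogeneous M q}"
  using assms
proof induction
  case sos_zero
  then show ?case by (auto intro: sos.sos_zero)
next
  case (sos_add_square s q)
  then obtain M1 where M1: "\<And>M. M \<ge> M1 \<Longrightarrow> homogenize (2 * M) s \<in> sos {q. homogeneous M q}" by blast
  obtain M2 where M2: "\<And>e. e \<in> Poly_Mapping.keys q \<Longrightarrow> wt e \<le> M2" using weight_bound by blast
  have "homogenize (2 * M) (s + q\<^sup>2) \<in> sos {q. homogeneous M q}" if M: "M \<ge> max 1 (max M1 M2)" for M
  proof -
    have "homogenize (2 * M) (q\<^sup>2) =
        homogenize M q ^ 2 + r_poly * (homogenize (M - 1) q * homogenize (M - 1) q)"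
      unfolding power2_eq_square using M M2 by (intro homogenize_mult) (force dest: M2)+
    also have "r_poly * (homogenize (M - 1) q * homogenize (M - 1) q) =
        (\<Sum>v\<in>UNIV. (mvar v * homogenize (M - 1) q) ^ 2)"
      unfolding r_poly_def sum_distrib_right power2_eq_square by (simp only: mult_ac)
    finally have eq: "homogenize (2 * M) (q\<^sup>2) =
        homogenize M q ^ 2 + (\<Sum>v\<in>UNIV. (mvar v * homogenize (M - 1) q) ^ 2)" .
    have "homogeneous M (mvar v * homogenize (M - 1) q)" for v
      using homogeneous_mult[OF homogeneous_mvar[of v] homogeneous_homogenize[of "M - 1" q]] M by simp
    then show ?thesis
      unfolding homogenize_add eq using M M1 homogeneous_homogenize
      by (intro sos_add sos_sum sos_square) auto
  qed
  then show ?case by blast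
qed

text \<open>The threshold depends on the coefficients of the combination: \<open>M\<close> must
  exceed their weights by 2 so that multiples of \<open>r_poly - 1\<close> cancel exactly.\<close>

lemma homogenize_ideal:
  assumes "j \<in> ideal.span (insert (r_poly - 1) pluecker_relations)"
  shows "\<exists>M0. \<forall>M\<ge>M0. homogenize M j \<in> pluecker_ideal"
  using assms
proof (induction rule: ideal.span_induct_alt)
  case base
  then show ?case by (simp add: pluecker_ideal_def ideal.span_zero)
next
  case (step a g j)
  then obtain M1 where M1: "\<And>M. M \<ge> M1 \<Longrightarrow> homogenize M j \<in> pluecker_ideal" by blast
  obtain M2 where M2: "\<And>e. e \<in> Poly_Mapping.keys a \<Longrightarrow> wt e \<le> M2" using weight_bound by blast
  have "homogenize M (a * g + j) \<in> pluecker_ideal" if M: "M \<ge> max M1 (M2 + 2)" for M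
  proof -
    have "homogenize M (a * g) \<in> pluecker_ideal"
    proof (cases "g = r_poly - 1")
      case True
      have "homogenize M (a * g) = homogenize (M - 2) a * r_poly - homogenize M a"
        using M by (simp add: True right_diff_distrib homogenize_diff homogenize_mult_quadratic homogeneous_r_poly)
      also have "\<dots> = 0" using M M2 by (subst homogenize_raise) force+
      finally show ?thesis by (simp add: pluecker_ideal_def ideal.span_zero)
    next
      case False
      then have g: "g \<in> pluecker_relations" using step by blast
      then have "homogenize M (a * g) = homogenize (M - 2) a * g"
        using M by (intro homogenize_mult_quadratic homogeneous_pluecker) auto
      then show ?thesis using g by (simp add: pluecker_ideal_def ideal.span_scale ideal.span_base)
    qed
    then show ?thesis
      using M1 M by (auto simp: homogenize_add pluecker_ideal_def intro: ideal.span_add)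
  qed
  then show ?case by blast
qed

section \<open>Positive sectional curvature\<close>

lemma biv_index_cases:
  fixes s :: "'n::{finite,linorder} biv_index"
  assumes "CARD('n) \<ge> 2"
  obtains i j where "i < j" "s = Abs_biv_index (i, j)" "Rep_biv_index s = (i, j)"
proof -
  obtain i j where ij: "Rep_biv_index s = (i, j)" by fastforce
  have "\<not> (\<forall>x y :: 'n. x = y)"
  proof
    assume "\<forall>x y :: 'n. x = y"
    then have "card (UNIV :: 'n set) \<le> 1" by (simp add: card_le_Suc0_iff_eq)
    then show False using assms by simp
  qed
  then have "i < j" using Rep_biv_index[of s] ij by auto
  then show thesis using that ij Rep_biv_index_inverse[of s] by auto
qed

lemma Rep_Abs_biv_index: "i < j \<Longrightarrow> Rep_biv_index (Abs_biv_index (i, j)) = (i, j)"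
  by (simp add: Abs_biv_index_inverse)

lemma wedge_nth: "i < j \<Longrightarrow> (X \<and>\<^sub>v Y) $ Abs_biv_index (i, j) = X $ i * Y $ j - X $ j * Y $ i"
  by (simp add: wedge_def Rep_Abs_biv_index)

text \<open>The three-term expression changes sign under each adjacent transposition, hence vanishes
  when neighbours coincide. The facts \<open>2\<close>, \<open>3\<close> and the last one sort the
  indices by insertion, one more arbitrary index each time.\<close>

lemma pluecker_antisymmetric:
  fixes t :: "'n::linorder \<Rightarrow> 'n \<Rightarrow> real"
  assumes anti: "\<And>i j. t j i = - t i j"
    and rel: "\<And>i j k l. i < j \<Longrightarrow> j < k \<Longrightarrow> k < l \<Longrightarrow> t i j * t k l - t i k * t j l + t i l * t j k = 0"
  shows "t i j * t k l - t i k * t j l + t i l * t j k = 0"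
proof -
  define P where "P i j k l = t i j * t k l - t i k * t j l + t i l * t j k" for i j k l
  have diag: "t i i = 0" for i using anti[of i i] by simp
  have swap: "P j i k l = - P i j k l" "P i k j l = - P i j k l" "P i j l k = - P i j k l" for i j k l
    using anti[of j i] anti[of j k] anti[of k l] by (simp_all add: P_def algebra_simps)
  have eq: "P i i k l = 0" "P i k k l = 0" "P i k l l = 0" for i k l
    using swap(1)[of i i k l] swap(2)[of i k k l] swap(3)[of i k l l] by simp_all
  have 1: "P i j k l = 0" if "i < j" "j < k" "k < l" for i j k l
    using rel[OF that] by (simp add: P_def)
  have 2: "P i j k l = 0" if "j < k" "k < l" for i j k l
    by (metis 1 eq swap linorder_neqE that neg_equal_0_iff_equal order.strict_trans)
  have 3: "P i j k l = 0" if "k < l" for i j k l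
    by (metis 2 eq swap linorder_neqE that neg_equal_0_iff_equal order.strict_trans)
  have "P i j k l = 0"
    by (metis 3 eq swap linorder_neqE neg_equal_0_iff_equal)
  then show ?thesis by (simp add: P_def)
qed

text \<open>If the entry at (a, b) of the skew matrix \<open>t\<close> is nonzero, the relation for
  a, b, i, j reads \<open>t a i * t b j - t a j * t b i = t a b * t i j\<close>: rows
  \<open>a\<close> and \<open>b\<close>, one of them divided by \<open>t a b\<close>, wedge to
  \<open>s\<close>.\<close>

lemma pluecker_decomposable:
  fixes s :: "'n::{finite,linorder} bivector"
  assumes n: "CARD('n) \<ge> 2" and s: "s \<noteq> 0"
    and rel: "\<And>i j k l. i < j \<Longrightarrow> j < k \<Longrightarrow> k < l \<Longrightarrow>
      s $ Abs_biv_index (i, j) * s $ Abs_biv_index (k, l) - s $ Abs_biv_index (i, k) * s $ Abs_biv_index (j, l)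
      + s $ Abs_biv_index (i, l) * s $ Abs_biv_index (j, k) = 0"
  obtains X Y where "s = X \<and>\<^sub>v Y"
proof -
  define t where "t i j = (if i < j then s $ Abs_biv_index (i, j)
    else if j < i then - s $ Abs_biv_index (j, i) else 0)" for i j
  have t: "t i j = s $ Abs_biv_index (i, j)" if "i < j" for i j using that by (simp add: t_def)
  have "t i j * t k l - t i k * t j l + t i l * t j k = 0" for i j k l
  proof (rule pluecker_antisymmetric)
    show "t j i = - t i j" for i j by (auto simp: t_def)
    show "t i j * t k l - t i k * t j l + t i l * t j k = 0" if "i < j" "j < k" "k < l" for i j k l
      using rel[OF that] that by (simp add: t)
  qed
  note rel' = this
  obtain p where p: "s $ p \<noteq> 0" using s by (auto simp: vec_eq_iff)
  obtain a b where ab: "a < b" "p = Abs_biv_index (a, b)" using biv_index_cases[OF n] by metis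
  then have nz: "t a b \<noteq> 0" using p t by simp
  have "s $ q = ((\<chi> i. t a i / t a b) \<and>\<^sub>v (\<chi> i. t b i)) $ q" for q
  proof -
    obtain i j where ij: "i < j" "q = Abs_biv_index (i, j)" using biv_index_cases[OF n] by metis
    have eq: "t a i * t b j - t a j * t b i = t a b * t i j"
      using rel'[of a b i j] by linarith
    have "((\<chi> i. t a i / t a b) \<and>\<^sub>v (\<chi> i. t b i)) $ q = (t a i * t b j - t a j * t b i) / t a b"
      by (simp add: ij(2) wedge_nth[OF ij(1)] diff_divide_distrib)
    also have "\<dots> = s $ q" unfolding eq using nz by (simp add: t[OF ij(1)] ij(2))
    finally show ?thesis ..
  qed
  then show thesis using that by (metis vec_eq_iff)
qed

lemma curv_form_sum: "curv_form R \<sigma> = (\<Sum>s\<in>UNIV. \<Sum>t\<in>UNIV. mat_of R $ s $ t * \<sigma> $ t * \<sigma> $ s)"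
  by (simp add: curv_form_def inner_vec_def matrix_vector_mult_def sum_distrib_right)

text \<open>The sums of squares in the coordinate ring of the unit decomposable bivectors, pulled
  back to the polynomial ring.\<close>

definition sphere_cone :: "('n::{finite,linorder}) biv_index mpoly set" where
  "sphere_cone = {s + j | s j. s \<in> sos UNIV \<and> j \<in> ideal.span (insert (r_poly - 1) pluecker_relations)}"

lemma sphere_coneI:
  "s \<in> sos UNIV \<Longrightarrow> j \<in> ideal.span (insert (r_poly - 1) pluecker_relations) \<Longrightarrow> s + j \<in> sphere_cone"
  by (auto simp: sphere_cone_def)

lemma sphere_cone_sos: "s \<in> sos UNIV \<Longrightarrow> s \<in> sphere_cone"
  using sphere_coneI[OF _ ideal.span_zero] by fastforce

lemma sphere_cone_ideal:
  "j \<in> ideal.span (insert (r_poly - 1) pluecker_relations) \<Longrightarrow> j \<in> sphere_cone"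
  using sphere_coneI[OF sos_zero] by fastforce

lemma preordering_sphere_cone: "mconst.preordering sphere_cone"
  unfolding mconst.preordering_def
proof (intro conjI ballI allI)
  fix a b :: "'a biv_index mpoly" assume "a \<in> sphere_cone" "b \<in> sphere_cone"
  then obtain s j s' j' where ab: "a = s + j" "b = s' + j'" and s: "s \<in> sos UNIV" "s' \<in> sos UNIV"
    and j: "j \<in> ideal.span (insert (r_poly - 1) pluecker_relations)"
      "j' \<in> ideal.span (insert (r_poly - 1) pluecker_relations)"
    unfolding sphere_cone_def by blast
  have "a + b = (s + s') + (j + j')" by (simp add: ab algebra_simps)
  then show "a + b \<in> sphere_cone" using sos_add s ideal.span_add j sphere_coneI by metis
  have "a * b = s * s' + (s * j' + b * j)" unfolding ab by (simp only: distrib_left distrib_right mult_ac add_ac)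
  moreover have "s * s' \<in> sos UNIV" using s by (intro sos_mult) auto
  moreover have "s * j' + b * j \<in> ideal.span (insert (r_poly - 1) pluecker_relations)"
    using j by (intro ideal.span_add ideal.span_scale)
  ultimately show "a * b \<in> sphere_cone" using sphere_coneI by metis
next
  show "a * a \<in> sphere_cone" for a :: "'a biv_index mpoly"
    using sphere_cone_sos[OF sos_square[of a UNIV]] by (simp add: power2_eq_square)
qed

text \<open>The elements bounded on both sides by constants form a subring, so it is enough to bound
  the variables. Modulo \<open>r_poly - 1\<close>, twice \<open>1 + x\<close> is
  \<open>(1 + x)\<^sup>2\<close> plus the squares of the other variables.\<close>

lemma sphere_cone_archimedean: "\<exists>k. mconst k - a \<in> sphere_cone"
proof -
  note cone_add = mconst.preordering_add[OF preordering_sphere_cone]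
    and cone_mult = mconst.preordering_mult[OF preordering_sphere_cone]
    and C = mconst.preordering_C[OF preordering_sphere_cone]
  have half: "a \<in> sphere_cone" if "a + a \<in> sphere_cone" for a :: "'a biv_index mpoly"
  proof -
    have "a = (mconst (1/2) + mconst (1/2)) * a" by (simp add: mconst.C_add[symmetric])
    also have "\<dots> = mconst (1/2) * (a + a)" by (simp only: distrib_left distrib_right)
    finally show ?thesis using cone_mult[OF C[of "1/2"] that] by simp
  qed
  have "\<exists>k. mconst k - a \<in> sphere_cone \<and> mconst k + a \<in> sphere_cone"
  proof (induction a rule: mpoly_gen_induct)
    case (const x)
    have "mconst \<bar>x\<bar> - mconst x \<in> sphere_cone" "mconst \<bar>x\<bar> + mconst x \<in> sphere_cone"
      unfolding mconst.C_diff[symmetric] mconst.C_add[symmetric] by (rule C; linarith)+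
    then show ?case by blast
  next
    case (var v)
    have v: "r_poly = mvar v ^ 2 + (\<Sum>w\<in>UNIV - {v}. mvar w ^ 2)"
      unfolding r_poly_def by (simp add: sum.remove)
    \<comment> \<open>Only the square of \<open>x\<close> enters, so both signs of the variable are
      treated at once.\<close>
    have "(1 + x) + (1 + x) \<in> sphere_cone" if x: "x ^ 2 = mvar v ^ 2" for x
    proof -
      have "(1 + x) + (1 + x) = ((1 + x) ^ 2 + (\<Sum>w\<in>UNIV - {v}. mvar w ^ 2)) + (- 1) * (r_poly - 1)"
        unfolding v x[symmetric] by (simp add: power2_eq_square algebra_simps)
      moreover have "(1 + x) ^ 2 + (\<Sum>w\<in>UNIV - {v}. mvar w ^ 2) \<in> sos UNIV"
        by (intro sos_add sos_sum sos_square) auto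
      moreover have "(- 1) * (r_poly - 1) \<in> ideal.span (insert (r_poly - 1) pluecker_relations)"
        by (intro ideal.span_scale ideal.span_base) auto
      ultimately show ?thesis using sphere_coneI by metis
    qed
    from half[OF this[of "mvar v"]] half[OF this[of "- mvar v"]]
    have "mconst 1 + mvar v \<in> sphere_cone" "mconst 1 - mvar v \<in> sphere_cone" by simp_all
    then show ?case by blast
  next
    case (add p q)
    then obtain k l where kl: "mconst k - p \<in> sphere_cone" "mconst k + p \<in> sphere_cone"
      "mconst l - q \<in> sphere_cone" "mconst l + q \<in> sphere_cone" by blast
    have "mconst (k + l) - (p + q) = (mconst k - p) + (mconst l - q)"
      "mconst (k + l) + (p + q) = (mconst k + p) + (mconst l + q)"
      by (simp_all only: mconst.C_add algebra_simps)
    then show ?case using cone_add[OF kl(1,3)] cone_add[OF kl(2,4)] by metis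
  next
    case (mult p q)
    then obtain k l where kl: "mconst k - p \<in> sphere_cone" "mconst k + p \<in> sphere_cone"
      "mconst l - q \<in> sphere_cone" "mconst l + q \<in> sphere_cone" by blast
    let ?k = "mconst k" and ?l = "mconst l"
    have "(?k + p) * (?l - q) + (?k - p) * (?l + q) \<in> sphere_cone"
      "(?k + p) * (?l + q) + (?k - p) * (?l - q) \<in> sphere_cone"
      by (rule cone_add; rule cone_mult; fact kl)+
    moreover have "(?k + p) * (?l - q) + (?k - p) * (?l + q) = (?k * ?l - p * q) + (?k * ?l - p * q)"
      "(?k + p) * (?l + q) + (?k - p) * (?l - q) = (?k * ?l + p * q) + (?k * ?l + p * q)"
      by (simp_all only: algebra_simps)
    ultimately show ?case using half mconst.C_mult by metis
  qed
  then show ?thesis by blast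
qed

lemma sec_positive_imp_inner_approx:
  fixes R :: "'n::{finite,linorder} curv_op"
  assumes n: "CARD('n) \<ge> 2" and pos: "\<And>X Y. norm (X \<and>\<^sub>v Y) = 1 \<Longrightarrow> 0 < curv_form R (X \<and>\<^sub>v Y)"
  shows "\<exists>m. R \<in> inner_approx m"
proof -
  have "quadratic_poly R \<in> sphere_cone"
  proof (rule mconst.archimedean_positivstellensatz[OF preordering_sphere_cone sphere_cone_archimedean])
    fix \<phi> :: "'n biv_index mpoly \<Rightarrow> real"
    assume hom: "\<And>a b. \<phi> (a + b) = \<phi> a + \<phi> b" "\<And>a b. \<phi> (a * b) = \<phi> a * \<phi> b"
      "\<And>x. \<phi> (mconst x) = x" and nn: "\<And>a. a \<in> sphere_cone \<Longrightarrow> 0 \<le> \<phi> a"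
    have h0: "\<phi> 0 = 0" and h1: "\<phi> 1 = 1" using hom(3)[of 0] hom(3)[of 1] by simp_all
    have hm: "\<phi> (- a) = - \<phi> a" for a using hom(1)[of a "- a"] h0 by simp
    have hd: "\<phi> (a - b) = \<phi> a - \<phi> b" for a b using hom(1)[of a "- b"] hm by simp
    have hs: "\<phi> (sum f I) = (\<Sum>i\<in>I. \<phi> (f i))" if "finite I" for f and I :: "'n biv_index set"
      using that by (induction I) (simp_all add: h0 hom)
    have ideal0: "\<phi> g = 0" if "g \<in> insert (r_poly - 1) pluecker_relations" for g
    proof -
      have "g \<in> ideal.span (insert (r_poly - 1) pluecker_relations)" using that by (rule ideal.span_base)
      then have "g \<in> sphere_cone" "- g \<in> sphere_cone"
        by (intro sphere_cone_ideal ideal.span_neg; assumption)+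
      from nn[OF this(1)] nn[OF this(2)] show ?thesis by (simp add: hm)
    qed
    define s :: "'n bivector" where "s = (\<chi> v. \<phi> (mvar v))"
    have "\<phi> r_poly = 1" using ideal0[of "r_poly - 1"] by (simp add: hd h1)
    then have "s \<bullet> s = 1" by (simp add: r_poly_def hs hom power2_eq_square inner_vec_def s_def)
    then have ns: "norm s = 1" by (simp add: norm_eq_1)
    have "s $ Abs_biv_index (i, j) * s $ Abs_biv_index (k, l) - s $ Abs_biv_index (i, k) * s $ Abs_biv_index (j, l)
      + s $ Abs_biv_index (i, l) * s $ Abs_biv_index (j, k) = 0" if "i < j" "j < k" "k < l" for i j k l
    proof -
      have "pvar i j * pvar k l - pvar i k * pvar j l + pvar i l * pvar j k \<in> pluecker_relations"
        using that unfolding pluecker_relations_def by blast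
      then show ?thesis using ideal0 by (fastforce simp: s_def hom hd pvar_def)
    qed
    then obtain X Y where XY: "s = X \<and>\<^sub>v Y"
      using pluecker_decomposable[OF n, of s] ns by fastforce
    have "\<phi> (quadratic_poly R) = curv_form R s"
      by (simp add: quadratic_poly_def hs hom curv_form_sum s_def)
    then show "0 < \<phi> (quadratic_poly R)" using pos[of X Y] ns XY by simp
  qed
  then obtain s j where s: "s \<in> sos UNIV" and j: "j \<in> ideal.span (insert (r_poly - 1) pluecker_relations)"
    and eq: "quadratic_poly R = s + j" unfolding sphere_cone_def by blast
  obtain M1 where M1: "\<And>M. M \<ge> M1 \<Longrightarrow> homogenize (2 * M) s \<in> sos {q. homogeneous M q}"
    using homogenize_sos[OF s] by blast
  obtain M2 where M2: "\<And>M. M \<ge> M2 \<Longrightarrow> homogenize M j \<in> pluecker_ideal"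
    using homogenize_ideal[OF j] by blast
  \<comment> \<open>Degree \<open>2 * (m + 1)\<close> passes both thresholds. The form of
    \<open>R\<close> has degree 2, so in this degree it acquires exactly
    \<open>homogenize (2 * m) 1\<close>, which is \<open>r_poly ^ m\<close>.\<close>
  define m where "m = M1 + M2"
  have "homog_monomial (2 * m) (0 :: 'n biv_index \<Rightarrow>\<^sub>0 nat) = r_poly ^ m"
    using homog_monomial_even[of 0 m] by simp
  then have "homogenize (2 * m) 1 = (r_poly ^ m :: 'n biv_index mpoly)"
    using homogenize_single[of "2 * m" "0 :: 'n biv_index \<Rightarrow>\<^sub>0 nat" 1] by simp
  then have "r_poly ^ m * quadratic_poly R = homogenize (2 * (m + 1)) (1 * quadratic_poly R)"
    using homogenize_mult_quadratic[OF homogeneous_quadratic_poly, of "2 * (m + 1)" 1 R] by simp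
  also have "\<dots> = homogenize (2 * (m + 1)) s + homogenize (2 * (m + 1)) j"
    unfolding eq mult_1 homogenize_add ..
  finally have "r_poly ^ m * quadratic_poly R - homogenize (2 * (m + 1)) s \<in> pluecker_ideal"
    using M2[of "2 * (m + 1)"] by (simp add: m_def)
  moreover have "homogenize (2 * (m + 1)) s \<in> sos {q. homogeneous (m + 1) q}"
    by (intro M1) (simp add: m_def)
  then obtain N q where "\<forall>k<N::nat. homogeneous (m + 1) (q k)" "homogenize (2 * (m + 1)) s = (\<Sum>k<N. q k ^ 2)"
    using sos_eq_sum by (metis mem_Collect_eq)
  ultimately have "R \<in> inner_approx m"
    unfolding inner_approx_def coord_ring_eq_def by (simp only: mem_Collect_eq) metis
  then show ?thesis ..
qed

section \<open>Nonnegative sectional curvature and the inner approximations\<close>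

lemma wedge_add_left: "(X + X') \<and>\<^sub>v Y = X \<and>\<^sub>v Y + X' \<and>\<^sub>v Y"
  and wedge_add_right: "X \<and>\<^sub>v (Y + Y') = X \<and>\<^sub>v Y + X \<and>\<^sub>v Y'"
  and wedge_scaleR_left: "(a *\<^sub>R X) \<and>\<^sub>v Y = a *\<^sub>R (X \<and>\<^sub>v Y)"
  and wedge_scaleR_right: "X \<and>\<^sub>v (a *\<^sub>R Y) = a *\<^sub>R (X \<and>\<^sub>v Y)"
  and wedge_self: "X \<and>\<^sub>v X = 0"
  and wedge_anticommute: "Y \<and>\<^sub>v X = - (X \<and>\<^sub>v Y)"
  unfolding wedge_def Let_def case_prod_beta vec_eq_iff
  by (auto simp: algebra_simps)

definition curv_bilinear :: "('n::{finite,linorder}) curv_op \<Rightarrow> 'n bivector \<Rightarrow> 'n bivector \<Rightarrow> real" where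
  "curv_bilinear R \<sigma> \<tau> = (mat_of R *v \<sigma>) \<bullet> \<tau>"

lemma curv_form_eq_bilinear: "curv_form R \<sigma> = curv_bilinear R \<sigma> \<sigma>"
  by (simp add: curv_form_def curv_bilinear_def)

lemma curv_bilinear_commute: "curv_bilinear R \<sigma> \<tau> = curv_bilinear R \<tau> \<sigma>"
  using mat_of[of R] by (auto simp: curv_bilinear_def sym2b_def inner_commute)

lemma curv_bilinear_add_left: "curv_bilinear R (\<sigma> + \<sigma>') \<tau> = curv_bilinear R \<sigma> \<tau> + curv_bilinear R \<sigma>' \<tau>"
  and curv_bilinear_scaleR_left: "curv_bilinear R (a *\<^sub>R \<sigma>) \<tau> = a * curv_bilinear R \<sigma> \<tau>"
  by (simp_all add: curv_bilinear_def matrix_vector_right_distrib inner_add_left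
      linear_scale[OF matrix_vector_mul_linear])

lemma curv_bilinear_add_right: "curv_bilinear R \<tau> (\<sigma> + \<sigma>') = curv_bilinear R \<tau> \<sigma> + curv_bilinear R \<tau> \<sigma>'"
  and curv_bilinear_scaleR_right: "curv_bilinear R \<tau> (a *\<^sub>R \<sigma>) = a * curv_bilinear R \<tau> \<sigma>"
  by (simp_all add: curv_bilinear_def inner_add_right)

lemma curv_form_scaleR: "curv_form R (a *\<^sub>R \<sigma>) = a\<^sup>2 * curv_form R \<sigma>"
  by (simp add: curv_form_eq_bilinear curv_bilinear_scaleR_left curv_bilinear_scaleR_right power2_eq_square)

lemma curv_form_0 [simp]: "curv_form R 0 = 0"
  by (simp add: curv_form_def)

lemma curv_form_op_add: "curv_form (R + S) \<sigma> = curv_form R \<sigma> + curv_form S \<sigma>"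
  by (simp add: curv_form_def plus_curv_op.rep_eq matrix_vector_mult_add_rdistrib inner_add_left)

lemma curv_form_op_scaleR: "curv_form (a *\<^sub>R R) \<sigma> = a * curv_form R \<sigma>"
  by (simp add: curv_form_def scaleR_curv_op.rep_eq scaleR_matrix_vector_assoc[symmetric])

lemma sec_nonneg_iff: "sec_nonneg R \<longleftrightarrow> (\<forall>X Y. 0 \<le> curv_form R (X \<and>\<^sub>v Y))"
proof
  assume sec: "sec_nonneg R"
  show "\<forall>X Y. 0 \<le> curv_form R (X \<and>\<^sub>v Y)"
  proof (intro allI)
    fix X Y
    show "0 \<le> curv_form R (X \<and>\<^sub>v Y)"
    proof (cases "X \<and>\<^sub>v Y = 0")
      case False
      define a where "a = norm (X \<and>\<^sub>v Y)"
      have a: "a > 0" using False by (simp add: a_def)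
      have "norm ((inverse a *\<^sub>R X) \<and>\<^sub>v Y) = 1" using a by (simp add: wedge_scaleR_left a_def)
      then have "0 \<le> curv_form R ((inverse a *\<^sub>R X) \<and>\<^sub>v Y)" using sec unfolding sec_nonneg_def by blast
      then show ?thesis using a by (simp add: wedge_scaleR_left curv_form_scaleR zero_le_mult_iff)
    qed simp
  qed
qed (auto simp: sec_nonneg_def)

section \<open>Evaluation of polynomials and soundness of the inner approximations\<close>

definition monomial_fun :: "('n \<Rightarrow>\<^sub>0 nat) \<Rightarrow> real ^ 'n \<Rightarrow> real" where
  "monomial_fun e x = (\<Prod>i\<in>Poly_Mapping.keys e. (x $ i) ^ Poly_Mapping.lookup e i)"

lemma mpoly_fun_eq_sum:
  "mpoly_fun p x = (\<Sum>e\<in>Poly_Mapping.keys p. Poly_Mapping.lookup p e * monomial_fun e x)"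
  by (simp add: mpoly_fun_def monomial_fun_def)

lemma monomial_fun_add: "monomial_fun (e + e') x = monomial_fun e x * monomial_fun e' x"
proof -
  have "monomial_fun e x = (\<Prod>i\<in>UNIV. (x $ i) ^ Poly_Mapping.lookup e i)" for e
    unfolding monomial_fun_def by (rule prod.mono_neutral_left) (auto simp: in_keys_iff)
  then show ?thesis by (simp add: lookup_add power_add prod.distrib)
qed

lemma mpoly_fun_0 [simp]: "mpoly_fun 0 x = 0"
  and mpoly_fun_single: "mpoly_fun (Poly_Mapping.single e a) x = a * monomial_fun e x"
  by (auto simp: mpoly_fun_eq_sum)

lemma mpoly_fun_mconst [simp]: "mpoly_fun (mconst a) x = a"
  and mpoly_fun_mvar [simp]: "mpoly_fun (mvar v) x = x $ v"
  by (simp_all add: mconst_def mvar_def mpoly_fun_single monomial_fun_def)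

lemma mpoly_fun_add [simp]: "mpoly_fun (p + q) x = mpoly_fun p x + mpoly_fun q x"
  unfolding mpoly_fun_eq_sum by (rule setsum_keys_plus_distrib) (auto simp: distrib_right)

lemma mpoly_fun_mult [simp]: "mpoly_fun (p * q) x = mpoly_fun p x * mpoly_fun q x"
proof (induction p rule: mpoly_keys_induct[OF subset_UNIV])
  case (2 e a)
  show ?case
  proof (induction q rule: mpoly_keys_induct[OF subset_UNIV])
    case (2 e' b)
    then show ?case by (simp add: mult_single mpoly_fun_single monomial_fun_add)
  next
    case (3 q q')
    then show ?case by (simp only: distrib_left mpoly_fun_add)
  qed simp
next
  case (3 p p')
  then show ?case by (simp only: distrib_right mpoly_fun_add)
qed simp

lemma mpoly_fun_diff [simp]: "mpoly_fun (p - q) x = mpoly_fun p x - mpoly_fun q x"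
  using mpoly_fun_add[of "p - q" q x] by simp

lemma mpoly_fun_1 [simp]: "mpoly_fun 1 x = 1"
  using mpoly_fun_mconst[of 1 x] by simp

lemma mpoly_fun_power [simp]: "mpoly_fun (p ^ k) x = mpoly_fun p x ^ k"
  by (induction k) simp_all

lemma mpoly_fun_sum [simp]: "mpoly_fun (sum f I) x = (\<Sum>i\<in>I. mpoly_fun (f i) x)"
  by (induction I rule: infinite_finite_induct) simp_all

text \<open>At \<open>X \<and>\<^sub>v Y\<close> the coordinates are the 2 x 2 minors of the matrix
  with rows \<open>X\<close> and \<open>Y\<close>, for which the Pluecker relations are
  identities.\<close>

lemma pluecker_ideal_vanishes:
  assumes "p \<in> pluecker_ideal"
  shows "mpoly_fun p (X \<and>\<^sub>v Y) = 0"
  using assms unfolding pluecker_ideal_def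
proof (induction rule: ideal.span_induct_alt)
  case (step a g q)
  then obtain i j k l where "i < j" "j < k" "k < l"
    and g: "g = pvar i j * pvar k l - pvar i k * pvar j l + pvar i l * pvar j k"
    unfolding pluecker_relations_def by blast
  then have "i < k" "j < l" "i < l" by auto
  then have "mpoly_fun g (X \<and>\<^sub>v Y) = 0"
    using \<open>i < j\<close> \<open>j < k\<close> \<open>k < l\<close> by (simp add: g pvar_def wedge_nth algebra_simps)
  then show ?case using step by simp
qed simp

text \<open>Evaluation at a unit decomposable bivector kills the ideal and turns
  \<open>r_poly\<close> into 1, so the sectional curvature itself becomes a sum of squares of
  reals.\<close>

lemma inner_approx_sec_nonneg:
  fixes R :: "('n::{finite,linorder}) curv_op"
  assumes "R \<in> inner_approx m"
  shows "sec_nonneg R"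
  unfolding sec_nonneg_def
proof (clarify)
  fix X Y :: "real ^ ('n::{finite,linorder})" assume n: "norm (X \<and>\<^sub>v Y) = 1"
  obtain N :: nat and q where "r_poly ^ m * quadratic_poly R - (\<Sum>k<N. q k ^ 2) \<in> pluecker_ideal"
    using assms unfolding inner_approx_def coord_ring_eq_def by blast
  from pluecker_ideal_vanishes[OF this, of X Y]
  have "mpoly_fun r_poly (X \<and>\<^sub>v Y) ^ m * mpoly_fun (quadratic_poly R) (X \<and>\<^sub>v Y)
      = (\<Sum>k<N. mpoly_fun (q k) (X \<and>\<^sub>v Y) ^ 2)" by simp
  moreover have "mpoly_fun r_poly (X \<and>\<^sub>v Y) = (X \<and>\<^sub>v Y) \<bullet> (X \<and>\<^sub>v Y)"
    by (simp add: r_poly_def inner_vec_def power2_eq_square)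
  then have "mpoly_fun r_poly (X \<and>\<^sub>v Y) = 1" using n by (simp add: dot_square_norm)
  moreover have "mpoly_fun (quadratic_poly R) (X \<and>\<^sub>v Y) = curv_form R (X \<and>\<^sub>v Y)"
    by (simp add: quadratic_poly_def curv_form_sum)
  ultimately have "curv_form R (X \<and>\<^sub>v Y) = (\<Sum>k<N. mpoly_fun (q k) (X \<and>\<^sub>v Y) ^ 2)" by simp
  also have "\<dots> \<ge> 0" by (intro sum_nonneg) simp
  finally show "0 \<le> curv_form R (X \<and>\<^sub>v Y)" .
qed

lemma convex_sec_nonneg: "convex {R :: ('n::{finite,linorder}) curv_op. sec_nonneg R}"
  unfolding convex_def by (auto simp: sec_nonneg_iff curv_form_op_add curv_form_op_scaleR)

lemma bad_inputs_frontier: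
  assumes n: "CARD('n::{finite,linorder}) \<ge> 2"
  shows "(bad_inputs :: 'n curv_op set) \<subseteq> frontier {R. sec_nonneg R}"
proof
  fix R :: "'n curv_op" assume bad: "R \<in> bad_inputs"
  then have sec: "sec_nonneg R" and not_in: "\<And>m. R \<notin> inner_approx m" by (auto simp: bad_inputs_def)
  have "R \<notin> interior {R. sec_nonneg R}"
  proof
    assume "R \<in> interior {R. sec_nonneg R}"
    then obtain e where e: "e > 0" "ball R e \<subseteq> {R. sec_nonneg R}" using mem_interior by blast
    define I :: "'n curv_op" where "I = Curv_op (mat 1)"
    have I: "curv_form I \<sigma> = \<sigma> \<bullet> \<sigma>" for \<sigma>
      by (simp add: curv_form_def I_def Curv_op_inverse mat_1_in_sym2b)
    \<comment> \<open>The summand 1 keeps the denominator positive and the perturbation strictly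
      inside the ball.\<close>
    define d where "d = e / (norm I + 1)"
    have d: "d > 0" using e by (simp add: d_def add_nonneg_pos)
    have "norm (d *\<^sub>R I) < e"
    proof -
      have "norm I < norm I + 1" by simp
      then show ?thesis using e by (simp add: d_def divide_less_eq add_nonneg_pos)
    qed
    then have "R + (- d) *\<^sub>R I \<in> ball R e" by (simp add: dist_norm)
    then have s: "sec_nonneg (R + (- d) *\<^sub>R I)" using e by blast
    have "0 < curv_form R (X \<and>\<^sub>v Y)" if "norm (X \<and>\<^sub>v Y) = 1" for X Y
    proof -
      have "0 \<le> curv_form (R + (- d) *\<^sub>R I) (X \<and>\<^sub>v Y)" using s by (simp only: sec_nonneg_iff)
      then have "d \<le> curv_form R (X \<and>\<^sub>v Y)"
        unfolding curv_form_op_add curv_form_op_scaleR I using that by (simp add: dot_square_norm)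
      then show ?thesis using d by simp
    qed
    then show False using sec_positive_imp_inner_approx[OF n] not_in by blast
  qed
  then show "R \<in> frontier {R. sec_nonneg R}"
    using sec closure_subset[of "{R. sec_nonneg R}"] by (auto simp: frontier_def)
qed

lemma bad_inputs_null:
  assumes "CARD('n::{finite,linorder}) \<ge> 2"
  shows "(bad_inputs :: 'n curv_op set) \<in> null_sets lebesgue"
  using negligible_subset[OF negligible_convex_frontier[OF convex_sec_nonneg] bad_inputs_frontier[OF assms]]
  by (simp add: negligible_iff_null_sets)

section \<open>The loop of the algorithm\<close>

lemma algorithm_eq:
  assumes "\<And>k. k < m \<Longrightarrow> R \<notin> inner_approx k \<and> R \<in> outer_approx c k"
  shows "algorithm c R 0 = algorithm c R m"
  using assms
proof (induction m)
  case (Suc m)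
  then have "algorithm c R 0 = algorithm c R m" by simp
  also have "\<dots> = algorithm c R (m + 1)"
    using Suc.prems[of m] by (subst algorithm.simps) simp
  finally show ?case by simp
qed simp

text \<open>At the least counter value where some test stops the loop, soundness decides the answer:
  under \<open>P\<close> no outer test fails, so the inner one succeeded; without \<open>P\<close>
  no inner test succeeds, so the outer one failed. Completeness of the two hierarchies only
  guarantees that such a value exists.\<close>

lemma algorithm_correct:
  assumes inner: "\<And>m. R \<in> inner_approx m \<Longrightarrow> P" and outer: "\<And>m. P \<Longrightarrow> R \<in> outer_approx c m"
    and pos: "P \<Longrightarrow> \<exists>m. R \<in> inner_approx m" and neg: "\<not> P \<Longrightarrow> \<exists>m. R \<notin> outer_approx c m"
  shows "algorithm c R 0 = Some P"
proof -
  define Q where "Q m \<longleftrightarrow> R \<in> inner_approx m \<or> R \<notin> outer_approx c m" for m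
  have ex: "\<exists>m. Q m" using pos neg by (cases P) (auto simp: Q_def)
  define m where "m = (LEAST m. Q m)"
  have m: "Q m" unfolding m_def using ex by (rule LeastI_ex)
  have "R \<notin> inner_approx k \<and> R \<in> outer_approx c k" if "k < m" for k
  proof -
    have "\<not> Q k" using that unfolding m_def by (rule not_less_Least)
    then show ?thesis by (simp add: Q_def)
  qed
  then have "algorithm c R 0 = algorithm c R m" by (rule algorithm_eq)
  also have "\<dots> = Some P"
  proof (cases P)
    case True
    then have "R \<in> inner_approx m" using m outer by (auto simp: Q_def)
    then show ?thesis using True by (subst algorithm.simps) simp
  next
    case False
    then have "R \<notin> inner_approx m" "R \<notin> outer_approx c m" using m inner by (auto simp: Q_def)
    then show ?thesis using False by (subst algorithm.simps) simp
  qed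
  finally show ?thesis .
qed

section \<open>The surface measure of the sphere\<close>

lemma sets_sphere_measure [simp, measurable_cong]: "sets sphere_measure = sets borel"
  by (simp add: sphere_measure_def)

lemma space_sphere_measure [simp]: "space sphere_measure = UNIV"
  by (simp add: sphere_measure_def space_scale_measure)

lemma measurable_sgn_vec: "(sgn :: real ^ 'n \<Rightarrow> real ^ 'n) \<in> borel_measurable borel"
proof -
  have "(\<lambda>x :: real ^ 'n. inverse (norm x) *\<^sub>R x) \<in> borel_measurable borel" by measurable
  then show ?thesis by (simp add: sgn_div_norm[abs_def])
qed

lemma emeasure_sphere_measure:
  assumes "A \<in> sets borel"
  shows "emeasure (sphere_measure :: (real ^ 'n) measure) A =
    of_nat CARD('n) * emeasure lborel (sgn -` A \<inter> ball 0 1)"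
proof -
  have m: "(sgn :: real ^ 'n \<Rightarrow> real ^ 'n) \<in> restrict_space lborel (ball 0 1) \<rightarrow>\<^sub>M borel"
    using measurable_sgn_vec by (intro measurable_restrict_space1) simp
  show ?thesis
    using assms by (simp add: sphere_measure_def emeasure_distr[OF m] space_restrict_space
        emeasure_restrict_space)
qed

lemma finite_sphere_measure: "finite_measure (sphere_measure :: (real ^ 'n) measure)"
proof
  have "emeasure lborel (ball (0 :: real ^ 'n) 1) < \<infinity>" by (rule emeasure_lborel_ball_finite)
  then show "emeasure (sphere_measure :: (real ^ 'n) measure) (space sphere_measure) \<noteq> \<infinity>"
    by (simp add: emeasure_sphere_measure ennreal_mult_eq_top_iff)
qed

interpretation sphere: finite_measure "sphere_measure :: (real ^ 'n) measure"
  by (rule finite_sphere_measure)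

text \<open>The measure lives on all of space but is pushed forward by \<open>sgn\<close>, whose
  values have norm 1 except at the origin, a null set. Pointwise estimates on unit vectors therefore
  suffice under the integral.\<close>

lemma AE_sphere: "AE x in sphere_measure. norm (x :: real ^ 'n) = 1"
proof (rule AE_I)
  show "{x \<in> space sphere_measure. norm (x :: real ^ 'n) \<noteq> 1} \<subseteq> {x. norm x \<noteq> 1}" by simp
  have s: "{x :: real ^ 'n. norm x \<noteq> 1} \<in> sets borel" by measurable
  then show "{x :: real ^ 'n. norm x \<noteq> 1} \<in> sets sphere_measure" by simp
  have "sgn -` {x :: real ^ 'n. norm x \<noteq> 1} \<inter> ball 0 1 = {0}" by (auto simp: norm_sgn)
  then show "emeasure sphere_measure {x :: real ^ 'n. norm x \<noteq> 1} = 0"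
    by (simp add: emeasure_sphere_measure[OF s])
qed

text \<open>The cone over \<open>U\<close> inside the punctured unit ball is open and contains
  \<open>u /\<^sub>R 2\<close>, so it has positive volume. The origin is removed because
  \<open>sgn\<close> is discontinuous there.\<close>

lemma sphere_measure_open_pos:
  fixes U :: "(real ^ 'n) set"
  assumes U: "open U" and u: "u \<in> U" "norm u = 1"
  shows "0 < measure sphere_measure U"
proof -
  let ?V = "{x \<in> ball 0 1 - {0}. sgn x \<in> U}"
  have cont: "continuous_on (ball 0 1 - {0}) (sgn :: real ^ 'n \<Rightarrow> real ^ 'n)"
    unfolding sgn_div_norm[abs_def] by (intro continuous_intros) auto
  have "open (ball 0 1 - {0 :: real ^ 'n})" by (simp add: open_delete)
  from continuous_open_preimage[OF cont this U]
  have "open ((ball 0 1 - {0}) \<inter> sgn -` U)" .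
  moreover have "?V = (ball 0 1 - {0}) \<inter> sgn -` U" by blast
  ultimately have V: "open ?V" by simp
  have "u /\<^sub>R 2 \<in> ?V" using u by (auto simp: sgn_div_norm)
  then have "?V \<noteq> {}" by blast
  with V have "\<not> negligible ?V" by (rule open_not_negligible)
  then have "?V \<notin> null_sets lebesgue" by (simp add: negligible_iff_null_sets)
  then have "emeasure lebesgue ?V \<noteq> 0" using V by (auto simp: null_sets_def)
  then have "emeasure lborel ?V \<noteq> 0" using V by simp
  moreover have sU: "sgn -` U \<inter> ball 0 1 \<in> sets borel"
    using measurable_sets[OF measurable_sgn_vec, of U] U by auto
  have "emeasure lborel ?V \<le> emeasure lborel (sgn -` U \<inter> ball 0 1)"
    using sU by (intro emeasure_mono) auto
  ultimately have "emeasure lborel (sgn -` U \<inter> ball 0 1) \<noteq> 0" by auto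
  then have "emeasure sphere_measure U \<noteq> 0" using U by (simp add: emeasure_sphere_measure)
  then show ?thesis by (simp add: sphere.emeasure_eq_measure zero_less_measure_iff)
qed

lemma integrable_sphere:
  fixes f :: "real ^ 'n \<Rightarrow> real"
  assumes "continuous_on UNIV f"
  shows "integrable sphere_measure f"
proof -
  have "compact (f ` sphere 0 1)"
    by (intro compact_continuous_image compact_sphere continuous_on_subset[OF assms]) auto
  then obtain B where "\<forall>y\<in>f ` sphere 0 1. norm y \<le> B"
    using compact_imp_bounded bounded_iff by metis
  then have B: "\<And>x. norm x = 1 \<Longrightarrow> norm (f x) \<le> B" by simp
  have "AE x in sphere_measure. norm (f x) \<le> B"
    using AE_sphere by eventually_elim (rule B)
  moreover have "f \<in> borel_measurable sphere_measure"
    using borel_measurable_continuous_onI[OF assms] by simp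
  ultimately show ?thesis by (rule sphere.integrable_const_bound)
qed

lemma integral_sphere_mono:
  fixes f g :: "real ^ 'n \<Rightarrow> real"
  assumes "integrable sphere_measure f" "integrable sphere_measure g" "\<And>x. norm x = 1 \<Longrightarrow> f x \<le> g x"
  shows "integral\<^sup>L sphere_measure f \<le> integral\<^sup>L sphere_measure g"
proof (rule integral_mono_AE[OF assms(1,2)])
  show "AE x in sphere_measure. f x \<le> g x" using AE_sphere by eventually_elim (rule assms(3))
qed

lemma integral_sphere_nonneg:
  fixes f :: "real ^ 'n \<Rightarrow> real"
  assumes "\<And>x. norm x = 1 \<Longrightarrow> 0 \<le> f x"
  shows "0 \<le> integral\<^sup>L sphere_measure f"
proof (rule integral_nonneg_AE)
  show "AE x in sphere_measure. 0 \<le> f x" using AE_sphere by eventually_elim (rule assms)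
qed

lemma integral_sphere_square_eq_0:
  fixes f :: "real ^ 'n \<Rightarrow> real"
  assumes f: "continuous_on UNIV f" and int: "(\<integral>x. f x * f x \<partial>sphere_measure) = 0" and u: "norm u = 1"
  shows "f u = 0"
proof (rule ccontr)
  assume nz: "f u \<noteq> 0"
  have "integrable sphere_measure (\<lambda>x. f x * f x)"
    by (intro integrable_sphere continuous_intros f)
  then have ae: "AE x in sphere_measure. f x * f x = 0"
    using int by (subst (asm) integral_nonneg_eq_0_iff_AE) auto
  have open_U: "open {x. f x \<noteq> 0}"
    using f by (intro open_Collect_neq) (auto intro: continuous_intros)
  have "emeasure sphere_measure {x. f x \<noteq> 0} = 0"
    using ae open_U by (subst (asm) AE_iff_measurable[OF _ refl]) auto
  then have "measure sphere_measure {x. f x \<noteq> 0} = 0" by (simp add: measure_def)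
  moreover have "0 < measure sphere_measure {x. f x \<noteq> 0}"
    using sphere_measure_open_pos[OF open_U, of u] nz u by simp
  ultimately show False by simp
qed

text \<open>Laplace's method: a high power of the weight \<open>w\<close> concentrates the integral where \<open>w = 1\<close>.\<close>

lemma sphere_concentration:
  fixes w g :: "real ^ 'n \<Rightarrow> real"
  assumes w: "continuous_on UNIV w" and g: "continuous_on UNIV g"
    and w01: "\<And>x. norm x = 1 \<Longrightarrow> 0 \<le> w x \<and> w x \<le> 1" and u: "norm u = 1" "w u = 1"
    and neg: "\<And>x. norm x = 1 \<Longrightarrow> w x = 1 \<Longrightarrow> g x < 0"
  shows "\<exists>k. (\<integral>x. w x ^ k * g x \<partial>sphere_measure) < 0"
proof -
  let ?S = "sphere (0 :: real ^ 'n) 1"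
  have wS: "continuous_on A w" and gS: "continuous_on A g" for A
    using w g continuous_on_subset by blast+
  have "compact (?S \<inter> w -` {1})"
    by (intro continuous_closed_preimage[THEN compact_Int_closed[OF compact_sphere], of UNIV, simplified] w) simp
  moreover have "u \<in> ?S \<inter> w -` {1}" using u by simp
  ultimately obtain x0 where x0: "x0 \<in> ?S \<inter> w -` {1}" "\<And>x. x \<in> ?S \<inter> w -` {1} \<Longrightarrow> g x \<le> g x0"
    using continuous_attains_sup[of "?S \<inter> w -` {1}" g] gS by blast
  \<comment> \<open>Half the distance of the maximum of \<open>g\<close> from 0, where the maximum
    is taken over the compact set of unit vectors with \<open>w = 1\<close>.\<close>
  define \<epsilon> where "\<epsilon> = - g x0 / 2"
  have eps: "\<epsilon> > 0" and far: "\<And>x. norm x = 1 \<Longrightarrow> w x = 1 \<Longrightarrow> g x < - \<epsilon>"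
    using x0 neg[of x0] by (force simp: \<epsilon>_def)+
  \<comment> \<open>The part of the sphere where \<open>g\<close> may fail to be clearly negative.
    It is compact and misses \<open>w = 1\<close>, so \<open>w\<close> stays below some
    \<open>\<rho> < 1\<close> there.\<close>
  let ?K = "?S \<inter> g -` {- \<epsilon>..}"
  have K: "compact ?K"
    by (intro continuous_closed_preimage[THEN compact_Int_closed[OF compact_sphere], of UNIV, simplified] g) simp
  obtain \<rho> where \<rho>: "0 \<le> \<rho>" "\<rho> < 1" "\<And>x. x \<in> ?K \<Longrightarrow> w x \<le> \<rho>"
  proof (cases "?K = {}")
    case False
    then obtain x1 where "x1 \<in> ?K" "\<And>x. x \<in> ?K \<Longrightarrow> w x \<le> w x1"
      using continuous_attains_sup[OF K] wS by blast
    moreover have "w x1 < 1" "0 \<le> w x1" using calculation(1) w01[of x1] far[of x1] by fastforce+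
    ultimately show thesis using that by blast
  qed (use that[of 0] in auto)
  \<comment> \<open>A level strictly between \<open>\<rho>\<close> and 1: the negative contribution
    from \<open>w > \<rho>'\<close> decays no faster than \<open>\<rho>' ^ k\<close>, the possibly
    positive one at least as fast as \<open>\<rho> ^ k\<close>.\<close>
  define \<rho>' where "\<rho>' = (1 + \<rho>) / 2"
  have \<rho>': "\<rho> < \<rho>'" "\<rho>' < 1" "0 < \<rho>'" using \<rho> by (simp_all add: \<rho>'_def)
  define U where "U = {x. \<rho>' < w x}"
  have U: "open U" unfolding U_def using w by (intro open_Collect_less) (auto intro: continuous_intros)
  define \<mu> where "\<mu> = measure sphere_measure U"
  have \<mu>: "\<mu> > 0" unfolding \<mu>_def by (rule sphere_measure_open_pos[OF U, of u]) (use u \<rho>' in \<open>auto simp: U_def\<close>)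
  have "bounded (g ` ?S)" by (intro compact_imp_bounded compact_continuous_image gS compact_sphere)
  then obtain G where G: "G > 0" "\<And>x. norm x = 1 \<Longrightarrow> \<bar>g x\<bar> \<le> G"
    by (auto simp: bounded_pos)
  define N where "N = measure sphere_measure (UNIV :: (real ^ 'n) set)"
  have bound: "(\<integral>x. w x ^ k * g x \<partial>sphere_measure) \<le> G * \<rho> ^ k * N - \<epsilon> * \<rho>' ^ k * \<mu>" for k
  proof -
    have "w x ^ k * g x \<le> G * \<rho> ^ k - \<epsilon> * \<rho>' ^ k * indicator U x" if x: "norm x = 1" for x
    proof (cases "x \<in> ?K")
      case True
      then have wx: "w x \<le> \<rho>" using \<rho> by blast
      then have "x \<notin> U" using \<rho>' by (simp add: U_def)
      moreover have "w x ^ k * g x \<le> \<rho> ^ k * G"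
        using wx w01[OF x] G(2)[OF x] \<rho>(1) G(1) abs_le_D1
        by (intro order_trans[OF mult_left_mono mult_right_mono] power_mono zero_le_power) force+
      ultimately show ?thesis by (simp add: mult.commute)
    next
      case False
      then have gx: "g x < - \<epsilon>" using x by auto
      have "w x ^ k * g x \<le> w x ^ k * (- \<epsilon>)" using gx w01[OF x] by (intro mult_left_mono) auto
      moreover have "\<rho>' ^ k * indicator U x \<le> w x ^ k"
        using w01[OF x] \<rho>' by (auto simp: indicator_def U_def intro: power_mono)
      then have "\<epsilon> * (\<rho>' ^ k * indicator U x) \<le> \<epsilon> * w x ^ k" using eps by (intro mult_left_mono) auto
      moreover have "0 \<le> G * \<rho> ^ k" using G \<rho> by simp
      ultimately show ?thesis by (simp add: mult.assoc mult.commute[of "w x ^ k"])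
    qed
    moreover have "integrable sphere_measure (\<lambda>x. w x ^ k * g x)"
      by (intro integrable_sphere continuous_intros w g)
    moreover have iU: "integrable sphere_measure (indicator U :: _ \<Rightarrow> real)"
      using U by (intro integrable_real_indicator) (auto simp: sphere.emeasure_finite less_top[symmetric])
    ultimately have "(\<integral>x. w x ^ k * g x \<partial>sphere_measure)
        \<le> (\<integral>x. G * \<rho> ^ k - \<epsilon> * \<rho>' ^ k * indicator U x \<partial>sphere_measure)"
      by (intro integral_sphere_mono) auto
    also have "\<dots> = G * \<rho> ^ k * N - \<epsilon> * \<rho>' ^ k * \<mu>"
      using iU by (simp add: N_def \<mu>_def)
    finally show ?thesis .
  qed
  have "(\<lambda>k. G * N * (\<rho> / \<rho>') ^ k) \<longlonglongrightarrow> G * N * 0"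
    using \<rho> \<rho>' by (intro tendsto_mult_left LIMSEQ_power_zero) auto
  moreover have "0 < \<epsilon> * \<mu>" using eps \<mu> by simp
  ultimately have "\<forall>\<^sub>F k in sequentially. G * N * (\<rho> / \<rho>') ^ k < \<epsilon> * \<mu>"
    by (intro order_tendstoD(2)) auto
  then obtain k where "G * N * (\<rho> / \<rho>') ^ k < \<epsilon> * \<mu>" by (auto simp: eventually_sequentially)
  then have "G * N * (\<rho> / \<rho>') ^ k * \<rho>' ^ k < \<epsilon> * \<mu> * \<rho>' ^ k" using \<rho>' by (intro mult_strict_right_mono) auto
  then have "G * \<rho> ^ k * N - \<epsilon> * \<rho>' ^ k * \<mu> < 0" using \<rho>' by (simp add: power_divide mult_ac)
  with bound[of k] show ?thesis by (intro exI[of _ k]) linarith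
qed

section \<open>The curvature terms on harmonic polynomials\<close>

text \<open>The spaces of harmonic polynomials depend on the degree and are sets of functions, so
  inner product spaces are axiomatized on a carrier set with pointwise operations.\<close>

locale fun_inner_space =
  fixes V :: "('a \<Rightarrow> real) set" and ip :: "('a \<Rightarrow> real) \<Rightarrow> ('a \<Rightarrow> real) \<Rightarrow> real"
  assumes zero: "(\<lambda>_. 0) \<in> V"
    and lin: "\<And>f g a b. f \<in> V \<Longrightarrow> g \<in> V \<Longrightarrow> (\<lambda>x. a * f x + b * g x) \<in> V"
    and ip_lin: "\<And>f g h a b. f \<in> V \<Longrightarrow> g \<in> V \<Longrightarrow> h \<in> V \<Longrightarrow>
      ip (\<lambda>x. a * f x + b * g x) h = a * ip f h + b * ip g h"
    and ip_commute: "\<And>f g. f \<in> V \<Longrightarrow> g \<in> V \<Longrightarrow> ip f g = ip g f"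
    and ip_nonneg: "\<And>f. f \<in> V \<Longrightarrow> 0 \<le> ip f f"
    and ip_definite: "\<And>f. f \<in> V \<Longrightarrow> ip f f = 0 \<Longrightarrow> f = (\<lambda>_. 0)"
begin

definition linear_functional :: "(('a \<Rightarrow> real) \<Rightarrow> real) \<Rightarrow> bool" where
  "linear_functional L \<longleftrightarrow> (\<forall>f\<in>V. \<forall>g\<in>V. \<forall>a b. L (\<lambda>x. a * f x + b * g x) = a * L f + b * L g)"

lemma linear_functionalD:
  "linear_functional L \<Longrightarrow> f \<in> V \<Longrightarrow> g \<in> V \<Longrightarrow> L (\<lambda>x. a * f x + b * g x) = a * L f + b * L g"
  by (simp add: linear_functional_def)

lemma linear_functional_ip: "h \<in> V \<Longrightarrow> linear_functional (\<lambda>f. ip f h)"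
  by (simp add: linear_functional_def ip_lin)

lemma sum_mem: "(\<And>i. i \<in> I \<Longrightarrow> \<phi> i \<in> V) \<Longrightarrow> (\<lambda>x. \<Sum>i\<in>I. a i * \<phi> i x) \<in> V"
proof (induction I rule: infinite_finite_induct)
  case (insert i I)
  then show ?case using lin[of "\<phi> i" "\<lambda>x. \<Sum>i\<in>I. a i * \<phi> i x" "a i" 1] by simp
qed (simp_all add: zero)

lemma linear_functional_sum:
  assumes L: "linear_functional L"
  shows "(\<And>i. i \<in> I \<Longrightarrow> \<phi> i \<in> V) \<Longrightarrow> L (\<lambda>x. \<Sum>i\<in>I. a i * \<phi> i x) = (\<Sum>i\<in>I. a i * L (\<phi> i))"
proof (induction I rule: infinite_finite_induct)
  case (insert i I)
  have "(\<lambda>x. \<Sum>i\<in>I. a i * \<phi> i x) \<in> V" using insert.prems by (intro sum_mem) auto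
  from linear_functionalD[OF L _ this, of "\<phi> i" "a i" 1] show ?case using insert by simp
qed (use linear_functionalD[OF L zero zero, of 0 0] in simp_all)

definition orthonormal :: "('a \<Rightarrow> real) set \<Rightarrow> bool" where
  "orthonormal E \<longleftrightarrow> finite E \<and> E \<subseteq> V \<and> (\<forall>e\<in>E. \<forall>e'\<in>E. ip e e' = (if e = e' then 1 else 0))"

text \<open>The given family may be linearly dependent: a vector whose residual has norm 0 is
  already expanded in \<open>E\<close> and adds nothing to it.\<close>

lemma gram_schmidt:
  assumes "finite I" "\<And>i. i \<in> I \<Longrightarrow> \<phi> i \<in> V"
  shows "\<exists>E. orthonormal E \<and> (\<forall>i\<in>I. \<phi> i = (\<lambda>x. \<Sum>e\<in>E. ip (\<phi> i) e * e x))"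
  using assms
proof (induction I)
  case empty
  then show ?case by (intro exI[of _ "{}"]) (simp add: orthonormal_def)
next
  case (insert j I)
  then obtain E where E: "orthonormal E" and \<phi>: "\<And>i. i \<in> I \<Longrightarrow> \<phi> i = (\<lambda>x. \<Sum>e\<in>E. ip (\<phi> i) e * e x)"
    by auto
  have fin: "finite E" and EV: "\<And>e. e \<in> E \<Longrightarrow> e \<in> V"
    and on: "\<And>e e'. e \<in> E \<Longrightarrow> e' \<in> E \<Longrightarrow> ip e e' = (if e = e' then 1 else 0)"
    using E by (auto simp: orthonormal_def)
  define g where "g = \<phi> j"
  have g: "g \<in> V" using insert.prems by (simp add: g_def)
  define s where "s = (\<lambda>x. \<Sum>e\<in>E. ip g e * e x)"
  have s: "s \<in> V" unfolding s_def by (rule sum_mem) (rule EV)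
  \<comment> \<open>The trivial coefficients here, and those in \<open>u\<close> below, give the
    functions the syntactic shape of \<open>lin\<close> and \<open>ip_lin\<close>.\<close>
  define w where "w = (\<lambda>x. 1 * g x + (- 1) * s x)"
  have w: "w \<in> V" unfolding w_def by (rule lin[OF g s])
  have s_e: "ip s e = ip g e" if "e \<in> E" for e
    unfolding s_def
    by (subst linear_functional_sum[OF linear_functional_ip]) (use that fin in \<open>auto simp: EV on if_distrib[of "\<lambda>t. _ * t"] cong: if_cong\<close>)
  have w_e: "ip w e = 0" if "e \<in> E" for e
    unfolding w_def by (subst ip_lin[OF g s EV[OF that]]) (simp add: s_e[OF that])
  show ?case
  proof (cases "ip w w = 0")
    case True
    then have "w = (\<lambda>_. 0)" by (rule ip_definite[OF w])
    then have "g = s" by (auto simp: w_def fun_eq_iff)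
    then show ?thesis using E \<phi> by (intro exI[of _ E]) (auto simp: g_def[symmetric] s_def)
  next
    case False
    define r where "r = sqrt (ip w w)"
    have r: "r > 0" "r * r = ip w w" using False ip_nonneg[OF w] by (simp_all add: r_def)
    define u where "u = (\<lambda>x. (1 / r) * w x + 0 * w x)"
    have u: "u \<in> V" unfolding u_def by (rule lin[OF w w])
    have u_h: "ip u h = ip w h / r" if "h \<in> V" for h
      unfolding u_def by (subst ip_lin[OF w w that]) simp
    have u_e: "ip u e = 0" "ip e u = 0" if "e \<in> E" for e
      using u_h[OF EV[OF that]] w_e[OF that] ip_commute[OF u EV[OF that]] by simp_all
    have "ip w u = ip w w / r" using u_h[OF w] ip_commute[OF w u] by simp
    then have w_u: "ip w u = r" unfolding r(2)[symmetric] using r(1) by simp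
    then have u_u: "ip u u = 1" using u_h[OF u] r(1) by simp
    have uE: "u \<notin> E" using u_e(1) u_u by fastforce
    have "orthonormal (insert u E)"
      using fin EV u on u_e u_u uE by (auto simp: orthonormal_def)
    moreover have "\<phi> i = (\<lambda>x. \<Sum>e\<in>insert u E. ip (\<phi> i) e * e x)" if i: "i \<in> insert j I" for i
    proof (cases "i = j")
      case True
      have "s = (\<lambda>x. \<Sum>e\<in>E. ip g e * e x)" by (fact s_def)
      then have "ip s u = 0"
        using linear_functional_sum[OF linear_functional_ip[OF u], of E "\<lambda>e. e" "ip g"] EV u_e by simp
      then have "ip w u = ip g u" unfolding w_def by (subst ip_lin[OF g s u]) simp
      then have "ip g u = r" using w_u by simp
      then show ?thesis using fin uE r True by (auto simp: g_def[symmetric] u_def w_def s_def fun_eq_iff)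
    next
      case False
      then have "i \<in> I" using i by simp
      have "ip (\<lambda>x. \<Sum>e\<in>E. ip (\<phi> i) e * e x) u = 0"
        using linear_functional_sum[OF linear_functional_ip[OF u], of E "\<lambda>e. e"] EV u_e by simp
      then have "ip (\<phi> i) u = 0" using \<phi>[OF \<open>i \<in> I\<close>] by simp
      then show ?thesis using \<phi>[OF \<open>i \<in> I\<close>] fin uE by simp
    qed
    ultimately show ?thesis by blast
  qed
qed

lemma orthonormal_basis_exists:
  assumes "finite I" "\<And>i. i \<in> I \<Longrightarrow> \<phi> i \<in> V" "\<And>f. f \<in> V \<Longrightarrow> \<exists>u. f = (\<lambda>x. \<Sum>i\<in>I. u i * \<phi> i x)"
  shows "\<exists>E. orthonormal E \<and> (\<forall>f\<in>V. f = (\<lambda>x. \<Sum>e\<in>E. ip f e * e x))"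
proof -
  obtain E where E: "orthonormal E" and \<phi>: "\<And>i. i \<in> I \<Longrightarrow> \<phi> i = (\<lambda>x. \<Sum>e\<in>E. ip (\<phi> i) e * e x)"
    using gram_schmidt[OF assms(1), of \<phi>] assms(2) by blast
  have "f x = (\<Sum>e\<in>E. ip f e * e x)" if f: "f \<in> V" for f x
  proof -
    obtain u where u: "f = (\<lambda>x. \<Sum>i\<in>I. u i * \<phi> i x)" using assms(3)[OF f] by blast
    have "ip f e = (\<Sum>i\<in>I. u i * ip (\<phi> i) e)" if "e \<in> E" for e
      unfolding u using that E assms(2)
      by (intro linear_functional_sum linear_functional_ip) (auto simp: orthonormal_def)
    then have "(\<Sum>e\<in>E. ip f e * e x) = (\<Sum>e\<in>E. \<Sum>i\<in>I. u i * (ip (\<phi> i) e * e x))"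
      by (simp add: sum_distrib_right mult.assoc)
    also have "\<dots> = (\<Sum>i\<in>I. u i * (\<Sum>e\<in>E. ip (\<phi> i) e * e x))"
      unfolding sum_distrib_left by (rule sum.swap)
    also have "\<dots> = f x" unfolding u using \<phi> by (intro sum.cong) (simp_all add: fun_eq_iff)
    finally show ?thesis ..
  qed
  with E show ?thesis by blast
qed

definition selfadjoint :: "(('a \<Rightarrow> real) \<Rightarrow> 'a \<Rightarrow> real) \<Rightarrow> bool" where
  "selfadjoint K \<longleftrightarrow> K \<in> V \<rightarrow>\<^sub>E V \<and>
     (\<forall>\<psi>\<in>V. \<forall>\<phi>\<in>V. \<forall>a b. K (\<lambda>x. a * \<psi> x + b * \<phi> x) = (\<lambda>x. a * K \<psi> x + b * K \<phi> x)) \<and>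
     (\<forall>\<psi>\<in>V. \<forall>\<phi>\<in>V. ip (K \<psi>) \<phi> = ip \<psi> (K \<phi>))"

text \<open>Comparison of the two quadratic forms at the sum of \<open>f\<close> and
  \<open>h\<close>; self-adjointness merges the mixed terms into twice
  \<open>ip (K f) h\<close>.\<close>

lemma selfadjoint_polarization:
  assumes K: "selfadjoint K" and B: "\<And>h. h \<in> V \<Longrightarrow> linear_functional (\<lambda>f. B f h)"
    and comm: "\<And>f h. f \<in> V \<Longrightarrow> h \<in> V \<Longrightarrow> B f h = B h f"
    and diag: "\<And>f. f \<in> V \<Longrightarrow> ip (K f) f = B f f" and f: "f \<in> V" and h: "h \<in> V"
  shows "ip (K f) h = B f h"
proof -
  have KV: "K f \<in> V" "K h \<in> V" using K f h by (auto simp: selfadjoint_def)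
  define q where "q = (\<lambda>x. 1 * f x + 1 * h x)"
  have q: "q \<in> V" unfolding q_def by (rule lin[OF f h])
  have Kq: "K q = (\<lambda>x. 1 * K f x + 1 * K h x)" using K f h unfolding q_def selfadjoint_def by blast
  have "ip (K q) q = ip (K f) q + ip (K h) q" unfolding Kq by (subst ip_lin[OF KV q]) simp
  moreover have "ip (K f) q = ip (K f) f + ip (K f) h" "ip (K h) q = ip (K h) f + ip (K h) h"
    using ip_lin[OF f h, of _ 1 1] KV q ip_commute f h by (simp_all add: q_def)
  moreover have "ip (K h) f = ip (K f) h"
  proof -
    have "ip (K h) f = ip h (K f)" using K f h unfolding selfadjoint_def by blast
    then show ?thesis using ip_commute[OF h KV(1)] by simp
  qed
  ultimately have 1: "ip (K q) q = ip (K f) f + ip (K h) h + 2 * ip (K f) h" by simp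
  have B_lin: "B q k = B f k + B h k" if "k \<in> V" for k
  proof -
    have "B q k = 1 * B f k + 1 * B h k"
      unfolding q_def by (rule linear_functionalD[OF B[OF that] f h])
    then show ?thesis by simp
  qed
  have "B q q = B f f + B h h + 2 * B f h"
    using B_lin[OF q] B_lin[OF f] B_lin[OF h] comm f h q by simp
  with 1 show ?thesis using diag f h q by simp
qed

text \<open>Existence is Riesz representation in an orthonormal basis: the coefficient of
  \<open>K f\<close> along \<open>e\<close> must be \<open>B f e\<close>. Uniqueness holds because
  polarization fixes all products \<open>ip (K f) h\<close> and the inner product is
  definite.\<close>

theorem selfadjoint_ex1:
  assumes fin: "finite I" "\<And>i. i \<in> I \<Longrightarrow> \<phi> i \<in> V" "\<And>f. f \<in> V \<Longrightarrow> \<exists>u. f = (\<lambda>x. \<Sum>i\<in>I. u i * \<phi> i x)"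
    and B: "\<And>h. h \<in> V \<Longrightarrow> linear_functional (\<lambda>f. B f h)"
    and comm: "\<And>f h. f \<in> V \<Longrightarrow> h \<in> V \<Longrightarrow> B f h = B h f"
  shows "\<exists>!K. selfadjoint K \<and> (\<forall>f\<in>V. ip (K f) f = B f f)"
proof (rule ex_ex1I)
  obtain E where E: "orthonormal E" and basis: "\<And>f. f \<in> V \<Longrightarrow> f = (\<lambda>x. \<Sum>e\<in>E. ip f e * e x)"
    using orthonormal_basis_exists[OF fin] by blast
  have EV: "\<And>e. e \<in> E \<Longrightarrow> e \<in> V" using E by (auto simp: orthonormal_def)
  \<comment> \<open>Restricted to \<open>V\<close>, since uniqueness needs a fixed value outside the
    carrier.\<close>
  define K where "K = (\<lambda>f\<in>V. \<lambda>x. \<Sum>e\<in>E. B f e * e x)"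
  have KV: "K f \<in> V" if "f \<in> V" for f
    using that EV by (auto simp: K_def intro: sum_mem)
  have K: "ip (K f) h = B f h" if f: "f \<in> V" and h: "h \<in> V" for f h
  proof -
    have "ip (K f) h = (\<Sum>e\<in>E. B f e * ip e h)"
      using f h EV linear_functional_sum[OF linear_functional_ip[OF h], of E "\<lambda>e. e"] by (simp add: K_def)
    also have "\<dots> = (\<Sum>e\<in>E. ip h e * B e f)"
      using f h EV ip_commute comm by (intro sum.cong) simp_all
    also have "\<dots> = B h f"
      using linear_functional_sum[OF B[OF f], of E "\<lambda>e. e" "ip h"] EV basis[OF h] by simp
    finally show ?thesis using comm[OF f h] by simp
  qed
  have "selfadjoint K"
    unfolding selfadjoint_def
  proof (intro conjI ballI allI)
    show "K \<in> V \<rightarrow>\<^sub>E V" using KV by (auto simp: K_def)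
  next
    fix f g a b assume f: "f \<in> V" and g: "g \<in> V"
    have "B (\<lambda>x. a * f x + b * g x) e = a * B f e + b * B g e" if "e \<in> E" for e
      by (rule linear_functionalD[OF B[OF EV[OF that]] f g])
    then show "K (\<lambda>x. a * f x + b * g x) = (\<lambda>x. a * K f x + b * K g x)"
      using f g by (simp add: K_def lin distrib_right sum.distrib sum_distrib_left mult.assoc)
  next
    fix f g assume "f \<in> V" "g \<in> V"
    then show "ip (K f) g = ip f (K g)" using K KV comm ip_commute by metis
  qed
  then show "\<exists>K. selfadjoint K \<and> (\<forall>f\<in>V. ip (K f) f = B f f)" using K by blast
next
  fix K K' assume K: "selfadjoint K \<and> (\<forall>f\<in>V. ip (K f) f = B f f)"
    and K': "selfadjoint K' \<and> (\<forall>f\<in>V. ip (K' f) f = B f f)"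
  show "K = K'"
  proof (rule PiE_ext)
    show "K \<in> V \<rightarrow>\<^sub>E V" "K' \<in> V \<rightarrow>\<^sub>E V" using K K' by (auto simp: selfadjoint_def)
    then have V: "K f \<in> V" "K' f \<in> V" if "f \<in> V" for f using that by auto
    fix f assume f: "f \<in> V"
    define d where "d = (\<lambda>x. 1 * K f x + (- 1) * K' f x)"
    have d: "d \<in> V" unfolding d_def by (rule lin[OF V[OF f]])
    have "ip d d = 1 * ip (K f) d + (- 1) * ip (K' f) d"
      unfolding d_def by (rule ip_lin[OF V[OF f] d[unfolded d_def]])
    also have "\<dots> = 0"
      using selfadjoint_polarization[of K B f d] selfadjoint_polarization[of K' B f d] K K' B comm f d
      by simp
    finally have "d = (\<lambda>_. 0)" by (rule ip_definite[OF d])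
    then show "K f = K' f" by (simp add: d_def fun_eq_iff)
  qed
qed

end

section \<open>Derivatives of polynomial functions and the spaces of harmonic polynomials\<close>

lemma partial_deriv_eq:
  assumes "(f has_derivative f') (at x)"
  shows "partial_deriv i f x = f' (axis i 1)"
  using frechet_derivative_at[OF assms] by (simp add: partial_deriv_def)

lemma gradient_eq:
  fixes f :: "real ^ 'n \<Rightarrow> real"
  assumes "(f has_derivative (\<lambda>h. v \<bullet> h)) (at x)"
  shows "gradient f x = v"
  by (simp add: vec_eq_iff gradient_def partial_deriv_eq[OF assms] inner_axis)

lemma partial_deriv_lincomb:
  assumes "f differentiable (at x)" "g differentiable (at x)"
  shows "partial_deriv i (\<lambda>x. a * f x + b * g x) x = a * partial_deriv i f x + b * partial_deriv i g x"
proof -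
  have "((\<lambda>x. a * f x + b * g x) has_derivative
      (\<lambda>h. a * frechet_derivative f (at x) h + b * frechet_derivative g (at x) h)) (at x)"
    by (intro has_derivative_add has_derivative_mult_right)
      (use assms frechet_derivative_works in blast)+
  from partial_deriv_eq[OF this] show ?thesis by (simp add: partial_deriv_def)
qed

text \<open>Both claims go through one induction because the product rule needs differentiable
  factors. Closure under partial derivatives is what makes gradients continuous and Laplacians
  accessible.\<close>

lemma mpoly_fun_derivatives:
  fixes P :: "'n::finite mpoly"
  shows "(\<forall>x. mpoly_fun P differentiable (at x)) \<and> (\<forall>i. \<exists>Q. partial_deriv i (mpoly_fun P) = mpoly_fun Q)"
proof (induction P rule: mpoly_gen_induct)
  case (const a)
  have eq: "mpoly_fun (mconst a :: 'n mpoly) = (\<lambda>x. a)" by (simp add: fun_eq_iff)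
  have "partial_deriv i (\<lambda>x :: real ^ 'n. a) = mpoly_fun 0" for i
    by (simp add: fun_eq_iff partial_deriv_eq[OF has_derivative_const])
  then have "\<exists>Q. partial_deriv i (\<lambda>x :: real ^ 'n. a) = mpoly_fun Q" for i by blast
  then show ?case unfolding eq by simp
next
  case (var v)
  have eq: "mpoly_fun (mvar v) = (\<lambda>x. x $ v)" by (simp add: fun_eq_iff)
  have d: "((\<lambda>x. x $ v) has_derivative (\<lambda>h. h $ v)) (at x)" for x :: "real ^ 'n"
    by (rule bounded_linear.has_derivative[OF bounded_linear_vec_nth has_derivative_ident])
  have "partial_deriv i (\<lambda>x. x $ v) = mpoly_fun (mconst (axis i 1 $ v))" for i
    by (simp add: fun_eq_iff partial_deriv_eq[OF d])
  moreover have "(\<lambda>x. x $ v) differentiable (at x)" for x :: "real ^ 'n"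
    using d by (auto simp: differentiable_def)
  ultimately show ?case unfolding eq by blast
next
  case (add p q)
  have eq: "mpoly_fun (p + q) = (\<lambda>x. 1 * mpoly_fun p x + 1 * mpoly_fun q x)" by (simp add: fun_eq_iff)
  have "(\<lambda>x. 1 * mpoly_fun p x + 1 * mpoly_fun q x) differentiable (at x)" for x
    using add by (auto intro!: derivative_intros)
  moreover have "\<exists>Q. partial_deriv i (\<lambda>x. 1 * mpoly_fun p x + 1 * mpoly_fun q x) = mpoly_fun Q" for i
  proof -
    obtain P Q where "partial_deriv i (mpoly_fun p) = mpoly_fun P" "partial_deriv i (mpoly_fun q) = mpoly_fun Q"
      using add by blast
    then have "partial_deriv i (\<lambda>x. 1 * mpoly_fun p x + 1 * mpoly_fun q x) = mpoly_fun (P + Q)"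
      using add partial_deriv_lincomb[of "mpoly_fun p" _ "mpoly_fun q" i 1 1] by (simp add: fun_eq_iff)
    then show ?thesis by blast
  qed
  ultimately show ?case unfolding eq by blast
next
  case (mult p q)
  have eq: "mpoly_fun (p * q) = (\<lambda>x. mpoly_fun p x * mpoly_fun q x)" by (simp add: fun_eq_iff)
  have "(\<lambda>x. mpoly_fun p x * mpoly_fun q x) differentiable (at x)" for x
    using mult by (auto intro!: derivative_intros)
  moreover have "\<exists>Q. partial_deriv i (\<lambda>x. mpoly_fun p x * mpoly_fun q x) = mpoly_fun Q" for i
  proof -
    obtain P Q where PQ: "partial_deriv i (mpoly_fun p) = mpoly_fun P" "partial_deriv i (mpoly_fun q) = mpoly_fun Q"
      using mult by blast
    have "((\<lambda>x. mpoly_fun p x * mpoly_fun q x) has_derivative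
      (\<lambda>h. mpoly_fun p x * frechet_derivative (mpoly_fun q) (at x) h
         + frechet_derivative (mpoly_fun p) (at x) h * mpoly_fun q x)) (at x)" for x
      by (intro has_derivative_mult) (use mult frechet_derivative_works in blast)+
    then have "partial_deriv i (\<lambda>x. mpoly_fun p x * mpoly_fun q x) x
      = mpoly_fun p x * partial_deriv i (mpoly_fun q) x + partial_deriv i (mpoly_fun p) x * mpoly_fun q x" for x
      by (subst partial_deriv_eq) (auto simp: partial_deriv_def)
    then have "partial_deriv i (\<lambda>x. mpoly_fun p x * mpoly_fun q x) = mpoly_fun (p * Q + P * q)"
      by (simp add: fun_eq_iff PQ)
    then show ?thesis by blast
  qed
  ultimately show ?case unfolding eq by blast
qed

lemma mpoly_fun_differentiable: "mpoly_fun P differentiable (at x)"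
  using mpoly_fun_derivatives by blast

lemma continuous_on_mpoly_fun: "continuous_on A (mpoly_fun P)"
  by (intro continuous_at_imp_continuous_on ballI differentiable_imp_continuous_within
      mpoly_fun_differentiable)

lemma continuous_on_gradient_mpoly_fun: "continuous_on A (gradient (mpoly_fun P))"
  unfolding gradient_def
proof (intro continuous_on_vec_lambda)
  fix i
  obtain Q where "partial_deriv i (mpoly_fun P) = mpoly_fun Q" using mpoly_fun_derivatives by blast
  then show "continuous_on A (\<lambda>x. partial_deriv i (mpoly_fun P) x)" by (simp add: continuous_on_mpoly_fun)
qed

lemma gradient_lincomb:
  assumes "f differentiable (at x)" "g differentiable (at x)"
  shows "gradient (\<lambda>x. a * f x + b * g x) x = a *\<^sub>R gradient f x + b *\<^sub>R gradient g x"
  by (simp add: vec_eq_iff gradient_def partial_deriv_lincomb[OF assms])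

lemma laplacian_mpoly_lincomb:
  "laplacian (\<lambda>x. a * mpoly_fun P x + b * mpoly_fun Q x) x =
    a * laplacian (mpoly_fun P) x + b * laplacian (mpoly_fun Q) x"
proof -
  have "partial_deriv i (partial_deriv i (\<lambda>x. a * mpoly_fun P x + b * mpoly_fun Q x)) x =
    a * partial_deriv i (partial_deriv i (mpoly_fun P)) x + b * partial_deriv i (partial_deriv i (mpoly_fun Q)) x" for i
  proof -
    obtain P' Q' where PQ: "partial_deriv i (mpoly_fun P) = mpoly_fun P'" "partial_deriv i (mpoly_fun Q) = mpoly_fun Q'"
      using mpoly_fun_derivatives by metis
    have "partial_deriv i (\<lambda>x. a * mpoly_fun P x + b * mpoly_fun Q x) =
      (\<lambda>x. a * mpoly_fun P' x + b * mpoly_fun Q' x)"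
      by (simp add: fun_eq_iff partial_deriv_lincomb mpoly_fun_differentiable PQ[symmetric])
    then show ?thesis by (simp add: PQ partial_deriv_lincomb mpoly_fun_differentiable)
  qed
  then show ?thesis by (simp add: laplacian_def sum.distrib sum_distrib_left)
qed

lemma harmonic_polys_lincomb:
  assumes "f \<in> harmonic_polys p" "g \<in> harmonic_polys p"
  shows "(\<lambda>x. a * f x + b * g x) \<in> harmonic_polys p"
proof -
  obtain P Q where f: "homogeneous p P" "f = mpoly_fun P" "\<And>x. laplacian (mpoly_fun P) x = 0"
    and g: "homogeneous p Q" "g = mpoly_fun Q" "\<And>x. laplacian (mpoly_fun Q) x = 0"
    using assms by (auto simp: harmonic_polys_def)
  have "(\<lambda>x. a * f x + b * g x) = mpoly_fun (mconst a * P + mconst b * Q)"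
    by (simp add: fun_eq_iff f g)
  moreover have "homogeneous p (mconst a * P + mconst b * Q)"
    using f g by (intro homogeneous_add homogeneous_mconst_mult)
  moreover have "laplacian (\<lambda>x. a * f x + b * g x) x = 0" for x
    by (simp add: f g laplacian_mpoly_lincomb)
  ultimately show ?thesis unfolding harmonic_polys_def by blast
qed

lemma harmonic_polys_mpoly:
  assumes "f \<in> harmonic_polys p"
  obtains P where "homogeneous p P" "f = mpoly_fun P"
  using assms by (auto simp: harmonic_polys_def)

lemma zero_harmonic_poly: "(\<lambda>_. 0) \<in> (harmonic_polys p :: (real ^ 'n \<Rightarrow> real) set)"
proof -
  have "partial_deriv i (\<lambda>x :: real ^ 'n. 0) = (\<lambda>x. 0)" for i
    by (simp add: fun_eq_iff partial_deriv_eq[OF has_derivative_const])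
  moreover have "(\<lambda>_. 0) = mpoly_fun (0 :: 'n mpoly)" by (simp add: fun_eq_iff)
  ultimately show ?thesis unfolding harmonic_polys_def
    by (auto simp: laplacian_def intro!: exI[of _ 0])
qed

lemma finite_wt: "finite {e :: 'n::finite \<Rightarrow>\<^sub>0 nat. wt e = p}"
proof (rule finite_imageD)
  have "Poly_Mapping.lookup e i \<le> wt e" for e :: "'n \<Rightarrow>\<^sub>0 nat" and i
    unfolding wt_def by (cases "i \<in> Poly_Mapping.keys e") (auto intro: member_le_sum simp: in_keys_iff)
  then have "Poly_Mapping.lookup ` {e :: 'n \<Rightarrow>\<^sub>0 nat. wt e = p} \<subseteq> UNIV \<rightarrow>\<^sub>E {..p}" by auto
  then show "finite (Poly_Mapping.lookup ` {e :: 'n \<Rightarrow>\<^sub>0 nat. wt e = p})"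
    by (rule finite_subset) (simp add: finite_PiE)
  show "inj_on Poly_Mapping.lookup {e :: 'n \<Rightarrow>\<^sub>0 nat. wt e = p}"
    by (auto simp: inj_on_def intro: poly_mapping_eqI)
qed

text \<open>The dimension argument takes place among formal polynomials, where the finitely many
  monomials of weight \<open>p\<close> span; evaluation then carries the spanning set over to
  functions.\<close>

lemma harmonic_polys_finite_span:
  obtains B :: "'n::finite mpoly set" where "finite B" "\<And>b. b \<in> B \<Longrightarrow> mpoly_fun b \<in> harmonic_polys p"
    "\<And>f. f \<in> harmonic_polys p \<Longrightarrow> \<exists>u. f = (\<lambda>x. \<Sum>b\<in>B. u b * mpoly_fun b x)"
proof -
  interpret vs: vector_space "\<lambda>(a :: real) (P :: 'n mpoly). mconst a * P"
    by unfold_locales (simp_all only: distrib_left distrib_right mconst.C_add mconst.C_mult mult.assoc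
        mconst.C_1 mult_1_left)
  let ?V = "{P :: 'n mpoly. homogeneous p P \<and> mpoly_fun P \<in> harmonic_polys p}"
  let ?T = "(\<lambda>e. Poly_Mapping.single e 1) ` {e :: 'n \<Rightarrow>\<^sub>0 nat. wt e = p}"
  obtain B where B: "B \<subseteq> ?V" "vs.independent B" "?V \<subseteq> vs.span B"
    by (rule vs.maximal_independent_subset)
  have "P \<in> vs.span ?T" if "homogeneous p P" for P
    using that
  proof (induction rule: homogeneous_induct)
    case (single e a)
    then have "Poly_Mapping.single e 1 \<in> vs.span ?T" by (intro vs.span_base) auto
    from vs.span_scale[OF this, of a] show ?case by (simp only: single_eq_mconst_mult[symmetric])
  qed (auto intro: vs.span_add vs.span_zero)
  then have "B \<subseteq> vs.span ?T" using B(1) by blast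
  then have fin: "finite B" using vs.independent_span_bound[OF _ B(2)] finite_wt by blast
  show thesis
  proof
    show "finite B" by (rule fin)
    show "mpoly_fun b \<in> harmonic_polys p" if "b \<in> B" for b using B(1) that by blast
    fix f assume f: "f \<in> (harmonic_polys p :: (real ^ 'n \<Rightarrow> real) set)"
    then obtain P where P: "homogeneous p P" "f = mpoly_fun P" by (rule harmonic_polys_mpoly)
    then have "P \<in> vs.span B" using B(3) f by blast
    then obtain u where "P = (\<Sum>b\<in>B. mconst (u b) * b)" unfolding vs.span_finite[OF fin] by blast
    then show "\<exists>u. f = (\<lambda>x. \<Sum>b\<in>B. u b * mpoly_fun b x)"
      using P(2) by (auto simp: fun_eq_iff)
  qed
qed

lemma mpoly_fun_homogeneous_scaleR:
  assumes "homogeneous p P"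
  shows "mpoly_fun P (t *\<^sub>R x) = t ^ p * mpoly_fun P x"
  using assms
proof (induction rule: homogeneous_induct)
  case (single e a)
  then show ?case
    by (simp add: mpoly_fun_single monomial_fun_def power_mult_distrib prod.distrib power_sum[symmetric] wt_def)
qed (simp_all add: distrib_left)

lemma harmonic_poly_continuous: "f \<in> harmonic_polys p \<Longrightarrow> continuous_on A f"
  by (auto elim!: harmonic_polys_mpoly simp: continuous_on_mpoly_fun)

lemma harmonic_poly_gradient_continuous: "f \<in> harmonic_polys p \<Longrightarrow> continuous_on A (gradient f)"
  by (auto elim!: harmonic_polys_mpoly simp: continuous_on_gradient_mpoly_fun)

lemma harmonic_poly_differentiable: "f \<in> harmonic_polys p \<Longrightarrow> f differentiable (at x)"
  by (auto elim!: harmonic_polys_mpoly simp: mpoly_fun_differentiable)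

text \<open>Definiteness is the point at issue: norm 0 forces vanishing on the sphere, homogeneity
  extends this along rays, and \<open>1 \<le> p\<close> covers the origin.\<close>

lemma harmonic_fun_inner_space:
  assumes p: "1 \<le> p"
  shows "fun_inner_space (harmonic_polys p :: (real ^ 'n \<Rightarrow> real) set) sphere_inner"
proof
  fix f g h :: "real ^ 'n \<Rightarrow> real" and a b
  assume f: "f \<in> harmonic_polys p" and g: "g \<in> harmonic_polys p" and h: "h \<in> harmonic_polys p"
  have "integrable sphere_measure (\<lambda>x. f x * h x)" "integrable sphere_measure (\<lambda>x. g x * h x)"
    by (intro integrable_sphere continuous_on_mult harmonic_poly_continuous[OF f]
        harmonic_poly_continuous[OF g] harmonic_poly_continuous[OF h])+
  then show "sphere_inner (\<lambda>x. a * f x + b * g x) h = a * sphere_inner f h + b * sphere_inner g h"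
    by (simp add: sphere_inner_def distrib_right mult.assoc)
next
  fix f :: "real ^ 'n \<Rightarrow> real" assume f: "f \<in> harmonic_polys p" and 0: "sphere_inner f f = 0"
  obtain P where P: "homogeneous p P" "f = mpoly_fun P" using f by (rule harmonic_polys_mpoly)
  have u: "f u = 0" if "norm u = 1" for u
    using integral_sphere_square_eq_0[OF harmonic_poly_continuous[OF f] _ that] 0 by (simp add: sphere_inner_def)
  have "f x = 0" for x
  proof (cases "x = 0")
    case True
    then show ?thesis using mpoly_fun_homogeneous_scaleR[OF P(1), of 0 0] p P(2) by (auto simp: power_0_left)
  next
    case False
    then have "f (norm x *\<^sub>R sgn x) = norm x ^ p * f (sgn x)" by (simp add: P mpoly_fun_homogeneous_scaleR)
    moreover have "norm x *\<^sub>R sgn x = x" using False by (simp add: sgn_div_norm)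
    ultimately show ?thesis using u[of "sgn x"] False by (simp add: norm_sgn)
  qed
  then show "f = (\<lambda>_. 0)" by auto
qed (auto simp: zero_harmonic_poly harmonic_polys_lincomb sphere_inner_def mult.commute
    intro: integral_sphere_nonneg)

lemma continuous_on_wedge [continuous_intros]:
  fixes f g :: "'a::topological_space \<Rightarrow> real ^ ('n::{finite,linorder})"
  assumes "continuous_on A f" "continuous_on A g"
  shows "continuous_on A (\<lambda>x. f x \<and>\<^sub>v g x)"
  unfolding wedge_def Let_def case_prod_beta
  using assms by (intro continuous_on_vec_lambda continuous_intros)

lemma continuous_on_curv_bilinear [continuous_intros]:
  assumes "continuous_on A f" "continuous_on A g"
  shows "continuous_on A (\<lambda>x. curv_bilinear R (f x) (g x))"
  unfolding curv_bilinear_def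
  by (intro continuous_on_inner bounded_linear.continuous_on[OF matrix_vector_mul_bounded_linear] assms)

text \<open>The polarized integral \<open>B\<close> is a symmetric bilinear form on a
  finite-dimensional space, so exactly one endomorphism represents it and the definite description
  denotes.\<close>

lemma curvature_term_inner:
  fixes R :: "('n::{finite,linorder}) curv_op"
  assumes p: "1 \<le> p" and \<psi>: "\<psi> \<in> harmonic_polys p"
  shows "sphere_inner (curvature_term c R p \<psi>) \<psi> =
    c p * (\<integral>x. curv_form R (x \<and>\<^sub>v gradient \<psi> x) \<partial>sphere_measure)"
proof -
  interpret fun_inner_space "harmonic_polys p :: (real ^ ('n::{finite,linorder}) \<Rightarrow> real) set" sphere_inner
    by (rule harmonic_fun_inner_space[OF p])
  define B where "B f g = c p * (\<integral>x. curv_bilinear R (x \<and>\<^sub>v gradient f x) (x \<and>\<^sub>v gradient g x) \<partial>sphere_measure)"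
    for f g :: "real ^ ('n::{finite,linorder}) \<Rightarrow> real"
  have int: "integrable sphere_measure (\<lambda>x. curv_bilinear R (x \<and>\<^sub>v gradient f x) (x \<and>\<^sub>v gradient g x))"
    if "f \<in> harmonic_polys p" "g \<in> harmonic_polys p" for f g
    using that by (intro integrable_sphere continuous_intros harmonic_poly_gradient_continuous)
  have B: "linear_functional (\<lambda>f. B f h)" if h: "h \<in> harmonic_polys p" for h
    unfolding linear_functional_def
  proof (intro ballI allI)
    fix f g :: "real ^ ('n::{finite,linorder}) \<Rightarrow> real" and a b
    assume f: "f \<in> harmonic_polys p" and g: "g \<in> harmonic_polys p"
    show "B (\<lambda>x. a * f x + b * g x) h = a * B f h + b * B g h"
      using int[OF f h] int[OF g h]
      by (simp add: B_def gradient_lincomb harmonic_poly_differentiable[OF f] harmonic_poly_differentiable[OF g]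
          wedge_add_right wedge_scaleR_right curv_bilinear_add_left curv_bilinear_scaleR_left algebra_simps)
  qed
  have comm: "B f g = B g f" for f g by (simp add: B_def curv_bilinear_commute)
  obtain F :: "'n mpoly set" where F: "finite F" "\<And>b. b \<in> F \<Longrightarrow> mpoly_fun b \<in> harmonic_polys p"
    "\<And>f. f \<in> harmonic_polys p \<Longrightarrow> \<exists>u. f = (\<lambda>x. \<Sum>b\<in>F. u b * mpoly_fun b x)"
    by (rule harmonic_polys_finite_span[of p]) blast
  have "\<exists>!K. selfadjoint K \<and> (\<forall>f\<in>harmonic_polys p. sphere_inner (K f) f = B f f)"
    by (rule selfadjoint_ex1[OF F B comm])
  moreover have "selfadjoint K = symmetric_endo (harmonic_polys p) K" for K
    by (simp add: selfadjoint_def symmetric_endo_def)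
  ultimately have "\<exists>!K. symmetric_endo (harmonic_polys p) K \<and>
     (\<forall>\<psi> \<in> harmonic_polys p. sphere_inner (K \<psi>) \<psi> =
        c p * (\<integral>x. curv_form R (x \<and>\<^sub>v gradient \<psi> x) \<partial>sphere_measure))"
    by (simp add: B_def curv_form_eq_bilinear)
  from theI'[OF this] show ?thesis using \<psi> unfolding curvature_term_def by blast
qed

section \<open>Harmonic polynomials concentrated on a great circle\<close>

definition plane_coord :: "real ^ 'n \<Rightarrow> real ^ 'n \<Rightarrow> real ^ 'n \<Rightarrow> complex" where
  "plane_coord u v x = Complex (x \<bullet> u) (x \<bullet> v)"

definition plane_re :: "real ^ 'n \<Rightarrow> real ^ 'n \<Rightarrow> nat \<Rightarrow> real ^ 'n \<Rightarrow> real" where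
  "plane_re u v k x = Re (plane_coord u v x ^ k)"

definition plane_im :: "real ^ 'n \<Rightarrow> real ^ 'n \<Rightarrow> nat \<Rightarrow> real ^ 'n \<Rightarrow> real" where
  "plane_im u v k x = Im (plane_coord u v x ^ k)"

lemma plane_coord_derivative: "(plane_coord u v has_derivative plane_coord u v) (at x)"
proof -
  have eq: "plane_coord u v = (\<lambda>x. complex_of_real (x \<bullet> u) + \<i> * complex_of_real (x \<bullet> v))"
    by (simp add: fun_eq_iff plane_coord_def Complex_eq)
  show ?thesis unfolding eq by (auto intro!: derivative_eq_intros)
qed

lemma plane_power_derivative:
  "((\<lambda>x. plane_coord u v x ^ k) has_derivative
    (\<lambda>h. of_nat k * plane_coord u v h * plane_coord u v x ^ (k - 1))) (at x)"
  by (rule has_derivative_power[OF plane_coord_derivative])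

text \<open>The real part of k z^(k-1) dz. For \<open>k = 0\<close> the truncated exponent is
  harmless because of the factor \<open>real k\<close>.\<close>

lemma plane_re_derivative:
  "(plane_re u v k has_derivative
    (\<lambda>h. (real k *\<^sub>R (plane_re u v (k - 1) x *\<^sub>R u - plane_im u v (k - 1) x *\<^sub>R v)) \<bullet> h)) (at x)"
proof -
  have "(\<lambda>h. Re (of_nat k * plane_coord u v h * plane_coord u v x ^ (k - 1))) =
    (\<lambda>h. (real k *\<^sub>R (plane_re u v (k - 1) x *\<^sub>R u - plane_im u v (k - 1) x *\<^sub>R v)) \<bullet> h)"
    by (simp add: fun_eq_iff plane_re_def plane_im_def plane_coord_def inner_diff_left inner_diff_right
        inner_commute algebra_simps del: of_real_power)
  then show ?thesis
    using bounded_linear.has_derivative[OF bounded_linear_Re plane_power_derivative[of u v k x]]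
    by (simp add: plane_re_def[abs_def])
qed

lemma plane_im_derivative:
  "(plane_im u v k has_derivative
    (\<lambda>h. (real k *\<^sub>R (plane_im u v (k - 1) x *\<^sub>R u + plane_re u v (k - 1) x *\<^sub>R v)) \<bullet> h)) (at x)"
proof -
  have "(\<lambda>h. Im (of_nat k * plane_coord u v h * plane_coord u v x ^ (k - 1))) =
    (\<lambda>h. (real k *\<^sub>R (plane_im u v (k - 1) x *\<^sub>R u + plane_re u v (k - 1) x *\<^sub>R v)) \<bullet> h)"
    by (simp add: fun_eq_iff plane_re_def plane_im_def plane_coord_def inner_add_left inner_add_right
        inner_commute algebra_simps del: of_real_power)
  then show ?thesis
    using bounded_linear.has_derivative[OF bounded_linear_Im plane_power_derivative[of u v k x]]
    by (simp add: plane_im_def[abs_def])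
qed

lemma plane_differentiable:
  "plane_re u v k differentiable (at x)" "plane_im u v k differentiable (at x)"
  using plane_re_derivative plane_im_derivative unfolding differentiable_def by blast+

lemma gradient_plane_re:
  "gradient (plane_re u v k) x = real k *\<^sub>R (plane_re u v (k - 1) x *\<^sub>R u - plane_im u v (k - 1) x *\<^sub>R v)"
  by (rule gradient_eq[OF plane_re_derivative])

lemma gradient_plane_im:
  "gradient (plane_im u v k) x = real k *\<^sub>R (plane_im u v (k - 1) x *\<^sub>R u + plane_re u v (k - 1) x *\<^sub>R v)"
  by (rule gradient_eq[OF plane_im_derivative])

lemma partial_deriv_plane_re:
  "partial_deriv i (plane_re u v k) =
    (\<lambda>x. (real k * u $ i) * plane_re u v (k - 1) x + (- (real k * v $ i)) * plane_im u v (k - 1) x)"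
  by (simp add: fun_eq_iff partial_deriv_eq[OF plane_re_derivative] inner_axis algebra_simps)

lemma partial_deriv_plane_im:
  "partial_deriv i (plane_im u v k) =
    (\<lambda>x. (real k * u $ i) * plane_im u v (k - 1) x + (real k * v $ i) * plane_re u v (k - 1) x)"
  by (simp add: fun_eq_iff partial_deriv_eq[OF plane_im_derivative] inner_axis algebra_simps)

text \<open>The Laplacian of z^k is k (k-1) z^(k-2) times |u|^2 - |v|^2 + 2 i (u . v), and this
  factor vanishes for orthonormal vectors.\<close>

lemma laplacian_plane:
  assumes "u \<bullet> u = 1" "v \<bullet> v = 1" "u \<bullet> v = 0"
  shows "laplacian (plane_re u v k) x = 0" "laplacian (plane_im u v k) x = 0"
proof -
  define c where "c = real k * real (k - 1)"
  define a where "a = plane_re u v (k - 1 - 1) x"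
  define b where "b = plane_im u v (k - 1 - 1) x"
  have s: "(\<Sum>i\<in>UNIV. u $ i * u $ i) = 1" "(\<Sum>i\<in>UNIV. v $ i * v $ i) = 1" "(\<Sum>i\<in>UNIV. u $ i * v $ i) = 0"
    using assms by (simp_all add: inner_vec_def)
  have "partial_deriv i (partial_deriv i (plane_re u v k)) x =
      c * a * (u $ i * u $ i) - 2 * c * b * (u $ i * v $ i) - c * a * (v $ i * v $ i)" for i
    unfolding partial_deriv_plane_re[of i u v k]
    by (subst partial_deriv_lincomb[OF plane_differentiable])
      (simp add: partial_deriv_plane_re partial_deriv_plane_im a_def b_def c_def algebra_simps)
  then show "laplacian (plane_re u v k) x = 0"
    by (simp add: laplacian_def sum.distrib sum_subtractf sum_distrib_left[symmetric] s)
  have "partial_deriv i (partial_deriv i (plane_im u v k)) x =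
      c * b * (u $ i * u $ i) + 2 * c * a * (u $ i * v $ i) - c * b * (v $ i * v $ i)" for i
    unfolding partial_deriv_plane_im[of i u v k]
    by (subst partial_deriv_lincomb[OF plane_differentiable(2,1)])
      (simp add: partial_deriv_plane_re partial_deriv_plane_im a_def b_def c_def algebra_simps)
  then show "laplacian (plane_im u v k) x = 0"
    by (simp add: laplacian_def sum.distrib sum_subtractf sum_distrib_left[symmetric] s)
qed

lemma plane_polynomials:
  fixes u v :: "real ^ 'n"
  shows "\<exists>P Q. homogeneous k P \<and> homogeneous k Q \<and> mpoly_fun P = plane_re u v k \<and> mpoly_fun Q = plane_im u v k"
proof (induction k)
  case 0
  have "mpoly_fun 1 = plane_re u v 0" "mpoly_fun 0 = plane_im u v 0"
    by (simp_all add: fun_eq_iff plane_re_def plane_im_def)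
  then show ?case using homogeneous_0 homogeneous_1 by blast
next
  case (Suc k)
  then obtain P Q where PQ: "homogeneous k P" "homogeneous k Q"
    "mpoly_fun P = plane_re u v k" "mpoly_fun Q = plane_im u v k" by blast
  define L :: "real ^ 'n \<Rightarrow> 'n mpoly" where "L w = (\<Sum>i\<in>UNIV. mconst (w $ i) * mvar i)" for w
  have L: "homogeneous 1 (L w)" "mpoly_fun (L w) x = x \<bullet> w" for w x
    unfolding L_def by (intro homogeneous_sum homogeneous_mconst_mult homogeneous_mvar)
      (simp add: inner_vec_def mult.commute)
  have "homogeneous (1 + k) (L u * P - L v * Q)" "homogeneous (1 + k) (L u * Q + L v * P)"
    using L PQ by (auto intro!: homogeneous_diff homogeneous_add homogeneous_mult simp del: One_nat_def plus_1_eq_Suc)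
  moreover have "mpoly_fun (L u * P - L v * Q) = plane_re u v (Suc k)"
    "mpoly_fun (L u * Q + L v * P) = plane_im u v (Suc k)"
    by (simp_all add: fun_eq_iff L PQ) (simp_all add: plane_re_def plane_im_def plane_coord_def)
  ultimately show ?case by auto
qed

lemma plane_harmonic:
  fixes u v :: "real ^ 'n"
  assumes "u \<bullet> u = 1" "v \<bullet> v = 1" "u \<bullet> v = 0"
  shows "plane_re u v k \<in> harmonic_polys k" "plane_im u v k \<in> harmonic_polys k"
proof -
  obtain P Q where "homogeneous k P" "homogeneous k Q" "plane_re u v k = mpoly_fun P" "plane_im u v k = mpoly_fun Q"
    using plane_polynomials[of k u v] by metis
  then show "plane_re u v k \<in> harmonic_polys k" "plane_im u v k \<in> harmonic_polys k"
    using laplacian_plane[OF assms] unfolding harmonic_polys_def by blast+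
qed

text \<open>Positivity of the constants reduces the spectral condition to the signs of the
  integrals.\<close>

lemma outer_approx_iff:
  fixes R :: "('n::{finite,linorder}) curv_op"
  assumes c: "\<forall>p\<ge>1. c p > 0"
  shows "R \<in> outer_approx c m \<longleftrightarrow> (\<forall>p. 1 \<le> p \<and> p \<le> m + 1 \<longrightarrow>
     (\<forall>\<psi>\<in>harmonic_polys p. 0 \<le> (\<integral>x. curv_form R (x \<and>\<^sub>v gradient \<psi> x) \<partial>sphere_measure)))"
  using c by (auto simp: outer_approx_def curvature_term_inner zero_le_mult_iff not_le[symmetric])

lemma sec_nonneg_outer_approx:
  assumes "\<forall>p\<ge>1. c p > 0" "sec_nonneg R"
  shows "R \<in> outer_approx c m"
  using assms(2) unfolding outer_approx_iff[OF assms(1)]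
  by (auto simp: sec_nonneg_iff intro: integral_sphere_nonneg)

lemma curv_form_lincomb:
  "curv_form R (a *\<^sub>R \<sigma> + b *\<^sub>R \<tau>) =
    a\<^sup>2 * curv_form R \<sigma> + 2 * a * b * curv_bilinear R \<sigma> \<tau> + b\<^sup>2 * curv_form R \<tau>"
  unfolding curv_form_eq_bilinear curv_bilinear_add_left curv_bilinear_add_right
    curv_bilinear_scaleR_left curv_bilinear_scaleR_right
  by (simp add: curv_bilinear_commute[of R \<tau> \<sigma>] power2_eq_square algebra_simps)

text \<open>Orthonormalizing a pair that spans a negative plane changes its wedge only by a nonzero
  factor, whose square scales the form.\<close>

lemma not_sec_nonneg_orthonormal:
  assumes "\<not> sec_nonneg R"
  obtains u v where "u \<bullet> u = 1" "v \<bullet> v = 1" "u \<bullet> v = 0" "curv_form R (u \<and>\<^sub>v v) < 0"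
proof -
  obtain X Y where neg: "curv_form R (X \<and>\<^sub>v Y) < 0" using assms by (auto simp: sec_nonneg_iff not_le)
  define u where "u = X /\<^sub>R norm X"
  have "X \<noteq> 0"
  proof
    assume "X = 0"
    then have "X \<and>\<^sub>v Y = 0" using wedge_scaleR_left[of 0 X Y] by simp
    then show False using neg by simp
  qed
  then have X: "X = norm X *\<^sub>R u" and u: "norm u = 1" by (simp_all add: u_def)
  then have uu: "u \<bullet> u = 1" by (simp add: norm_eq_1)
  define Z where "Z = Y + (- (Y \<bullet> u)) *\<^sub>R u"
  have uZ: "u \<bullet> Z = 0" by (simp add: Z_def inner_diff_right uu inner_commute)
  have "u \<and>\<^sub>v Z = u \<and>\<^sub>v Y" unfolding Z_def wedge_add_right wedge_scaleR_right wedge_self by simp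
  then have XY: "X \<and>\<^sub>v Y = norm X *\<^sub>R (u \<and>\<^sub>v Z)" using X wedge_scaleR_left by metis
  define v where "v = Z /\<^sub>R norm Z"
  have "Z \<noteq> 0"
  proof
    assume "Z = 0"
    then have "u \<and>\<^sub>v Z = 0" using wedge_scaleR_right[of u 0 Z] by simp
    then show False using neg XY by simp
  qed
  then have Z: "Z = norm Z *\<^sub>R v" and v: "norm v = 1" by (simp_all add: v_def)
  have "X \<and>\<^sub>v Y = (norm X * norm Z) *\<^sub>R (u \<and>\<^sub>v v)"
    using XY Z wedge_scaleR_right[of u "norm Z" v] by simp
  then have "curv_form R (u \<and>\<^sub>v v) < 0"
    using neg by (simp add: curv_form_scaleR mult_less_0_iff)
  moreover have "v \<bullet> v = 1" using v by (simp only: norm_eq_1)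
  moreover have "u \<bullet> v = 0" using uZ by (simp add: v_def)
  ultimately show thesis using that uu by blast
qed

text \<open>
  The test functions are the real and imaginary parts of \<open>(x \<bullet> u + i x \<bullet> v)\<^bsup>k+1\<^esup>\<close>; adding their two
  integrands leaves \<open>(k+1)\<^sup>2 (R(x\<and>u, x\<and>u) + R(x\<and>v, x\<and>v))\<close> weighted by a power that
  concentrates on the great circle spanned by \<open>u\<close> and \<open>v\<close>.
\<close>

lemma not_sec_nonneg_outer_approx:
  fixes R :: "('n::{finite,linorder}) curv_op"
  assumes c: "\<forall>p\<ge>1. c p > 0" and R: "\<not> sec_nonneg R"
  shows "\<exists>m. R \<notin> outer_approx c m"
proof (rule ccontr)
  assume "\<not> ?thesis"
  then have outer: "0 \<le> (\<integral>x. curv_form R (x \<and>\<^sub>v gradient \<psi> x) \<partial>sphere_measure)"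
    if "\<psi> \<in> harmonic_polys (Suc k)" for k \<psi>
    using outer_approx_iff[OF c, of R k] that by auto
  obtain u v where uv: "u \<bullet> u = 1" "v \<bullet> v = 1" "u \<bullet> v = 0" and neg: "curv_form R (u \<and>\<^sub>v v) < 0"
    using not_sec_nonneg_orthonormal[OF R] .
  define w where "w x = (x \<bullet> u)\<^sup>2 + (x \<bullet> v)\<^sup>2" for x
  define g where "g x = curv_form R (x \<and>\<^sub>v u) + curv_form R (x \<and>\<^sub>v v)" for x
  \<comment> \<open>On the sphere \<open>1 - w x\<close> is the squared distance to the plane of
    \<open>u\<close> and \<open>v\<close>; this yields \<open>w x \<le> 1\<close>, with equality
    only on the great circle.\<close>
  have residual: "(norm (x - ((x \<bullet> u) *\<^sub>R u + (x \<bullet> v) *\<^sub>R v)))\<^sup>2 = 1 - w x" if "norm x = 1" for x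
  proof -
    have "x \<bullet> x = 1" using that by (simp add: norm_eq_1)
    then show ?thesis
      unfolding power2_norm_eq_inner using uv
      by (simp add: w_def inner_diff_left inner_diff_right inner_add_left inner_add_right inner_commute
          power2_eq_square algebra_simps)
  qed
  have cw: "continuous_on UNIV w" unfolding w_def[abs_def] by (intro continuous_intros)
  have cg: "continuous_on UNIV g"
    unfolding g_def[abs_def] curv_form_eq_bilinear by (intro continuous_intros)
  have "\<exists>k. (\<integral>x. w x ^ k * g x \<partial>sphere_measure) < 0"
  proof (rule sphere_concentration[OF cw cg, of u])
    show "0 \<le> w x \<and> w x \<le> 1" if "norm x = 1" for x
      using residual[OF that] zero_le_power2[of "norm (x - ((x \<bullet> u) *\<^sub>R u + (x \<bullet> v) *\<^sub>R v))"]
      by (simp add: w_def)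
    show "norm u = 1" "w u = 1" using uv by (simp_all add: norm_eq_1 w_def)
    show "g x < 0" if x: "norm x = 1" "w x = 1" for x
    proof -
      define a where "a = x \<bullet> u"
      define b where "b = x \<bullet> v"
      have "x = a *\<^sub>R u + b *\<^sub>R v" using residual[OF x(1)] x(2) by (simp add: a_def b_def)
      then have "x \<and>\<^sub>v u = (- b) *\<^sub>R (u \<and>\<^sub>v v)" "x \<and>\<^sub>v v = a *\<^sub>R (u \<and>\<^sub>v v)"
        by (simp_all add: wedge_add_left wedge_scaleR_left wedge_self wedge_anticommute[of v u])
      then have "g x = (a\<^sup>2 + b\<^sup>2) * curv_form R (u \<and>\<^sub>v v)"
        unfolding g_def by (simp only: curv_form_scaleR) (simp add: algebra_simps)
      then show ?thesis using x(2) neg by (simp add: w_def a_def b_def)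
    qed
  qed
  then obtain k where k: "(\<integral>x. w x ^ k * g x \<partial>sphere_measure) < 0" ..
  let ?P = "plane_re u v (Suc k)" and ?Q = "plane_im u v (Suc k)"
  note harm = plane_harmonic[OF uv, of "Suc k"]
  have int: "integrable sphere_measure (\<lambda>x. curv_form R (x \<and>\<^sub>v gradient \<psi> x))"
    if "\<psi> \<in> harmonic_polys (Suc k)" for \<psi>
    unfolding curv_form_eq_bilinear
    using that by (intro integrable_sphere continuous_intros harmonic_poly_gradient_continuous)
  \<comment> \<open>The two gradients are related by a quarter turn in the coefficients, so the
    mixed terms in \<open>x \<and>\<^sub>v u\<close> and \<open>x \<and>\<^sub>v v\<close> cancel
    and the squares combine to \<open>a\<^sup>2 + b\<^sup>2 = w x ^ k\<close>.\<close>
  have "curv_form R (x \<and>\<^sub>v gradient ?P x) + curv_form R (x \<and>\<^sub>v gradient ?Q x) = (real (Suc k))\<^sup>2 * (w x ^ k * g x)" for x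
  proof -
    define a where "a = plane_re u v k x"
    define b where "b = plane_im u v k x"
    have "a\<^sup>2 + b\<^sup>2 = (cmod (plane_coord u v x ^ k))\<^sup>2"
      unfolding a_def b_def plane_re_def plane_im_def by (rule cmod_power2[symmetric])
    also have "\<dots> = ((cmod (plane_coord u v x))\<^sup>2) ^ k"
      by (simp add: norm_power power_mult[symmetric] mult.commute)
    also have "(cmod (plane_coord u v x))\<^sup>2 = w x" by (simp add: cmod_power2 plane_coord_def w_def)
    finally have ab: "a\<^sup>2 + b\<^sup>2 = w x ^ k" .
    have P: "x \<and>\<^sub>v gradient ?P x = real (Suc k) *\<^sub>R (a *\<^sub>R (x \<and>\<^sub>v u) + (- b) *\<^sub>R (x \<and>\<^sub>v v))"
      unfolding gradient_plane_re wedge_scaleR_right diff_conv_add_uminus wedge_add_right a_def b_def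
      using wedge_scaleR_right[of x "- plane_im u v k x" v] by simp
    have Q: "x \<and>\<^sub>v gradient ?Q x = real (Suc k) *\<^sub>R (b *\<^sub>R (x \<and>\<^sub>v u) + a *\<^sub>R (x \<and>\<^sub>v v))"
      unfolding gradient_plane_im wedge_scaleR_right wedge_add_right a_def b_def by simp
    have "curv_form R (x \<and>\<^sub>v gradient ?P x) + curv_form R (x \<and>\<^sub>v gradient ?Q x)
        = (real (Suc k))\<^sup>2 * ((a\<^sup>2 + b\<^sup>2) * g x)"
      unfolding P Q curv_form_scaleR curv_form_lincomb g_def by (simp add: algebra_simps)
    then show ?thesis unfolding ab .
  qed
  then have "(\<integral>x. curv_form R (x \<and>\<^sub>v gradient ?P x) \<partial>sphere_measure)
      + (\<integral>x. curv_form R (x \<and>\<^sub>v gradient ?Q x) \<partial>sphere_measure)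
      = (real (Suc k))\<^sup>2 * (\<integral>x. w x ^ k * g x \<partial>sphere_measure)"
    by (simp add: Bochner_Integration.integral_add[OF int[OF harm(1)] int[OF harm(2)], symmetric])
  also have "\<dots> < 0" using k by (simp add: mult_less_0_iff)
  finally show False using outer[OF harm(1)] outer[OF harm(2)] by linarith
qed

theorem proposition5p9:
  fixes c :: "nat \<Rightarrow> real"
  assumes "CARD('n::{finite,linorder}) \<ge> 5"
    and "\<forall>p\<ge>1. c p > 0"
  shows "(\<forall>R :: 'n curv_op. R \<notin> bad_inputs \<longrightarrow>
            (\<exists>b. algorithm c R 0 = Some b) \<and>
            (algorithm c R 0 = Some True \<longleftrightarrow> sec_nonneg R)) \<and>
         (bad_inputs :: 'n curv_op set) \<in> null_sets lebesgue \<and>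
         (bad_inputs :: 'n curv_op set) \<subseteq> frontier {R. sec_nonneg R}"
proof -
  \<comment> \<open>Being outside the bad set supplies the inner certificate when the sectional
    curvature is nonnegative; otherwise some outer test fails.\<close>
  have "algorithm c R 0 = Some (sec_nonneg R)" if "R \<notin> bad_inputs" for R :: "'n curv_op"
    using that inner_approx_sec_nonneg sec_nonneg_outer_approx[OF assms(2)]
      not_sec_nonneg_outer_approx[OF assms(2)]
    by (intro algorithm_correct) (auto simp: bad_inputs_def)
  moreover have n: "CARD('n) \<ge> 2" using assms(1) by simp
  ultimately show ?thesis using bad_inputs_null[OF n] bad_inputs_frontier[OF n] by simp
qed

end
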